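(* Let $\rho$ be the autocovariance function of the weakly stationary solution $X$ of the ARCH($\infty$) equations with data $a$, $b$, $\xi$. Suppose that $\lambda_1\sum_{j=1}^\infty b(j)<1$ and $\Omega<1$. If $b\in\mathcal{W}^{\downarrow}(1)$, then $\rho\in\mathcal{W}^{\downarrow}(1)$ (i.e. $(\rho(n))_{n\ge 0}\in\mathcal{W}^{\downarrow}(1)$). Moreover, $\lim_{n\to\infty}\rho(n)/b(n)$ exists and $$\lim_{n\to\infty}\frac{\rho(n)}{b(n)}=\frac{\lambda_1}{1-\lambda_1B}\sum_{j=-\infty}^{\infty}\rho(j)=\frac{\lambda_1\,\mathbb{E}[\nu(0)^2]}{(1-\lambda_1B)^3}.$$
   Context: ARCH($\infty$) setting. Let $\xi=\{\xi(k)\}_{k\in\mathbb{Z}}$ be i.i.d. non-negative random variables, $a\ge 0$ a constant, and $b=\{b(j)\}_{j\ge1}$ a real sequence with $b(j)\ge 0$. A random sequence $X=\{X(k)\}_{k\in\mathbb{Z}}$ satisfies the ARCH($\infty$) equations if $X(k)=\varsigma(k)\xi(k)$, $\varsigma(k)=a+\sum_{j=1}^\infty b(j)X(k-j)$ for all $k\in\mathbb{Z}$. Put $\lambda_1=\mathbb{E}[\xi(0)]$, $\lambda_2=\mathbb{E}[\xi(0)^2]$, $\sigma^2=\mathrm{Var}[\xi(0)]=\lambda_2-\lambda_1^2$, $B=\sum_{j=1}^\infty b(j)$, $\nu(k)=X(k)-\lambda_1\varsigma(k)$. Standing assumptions: $\lambda_1\in(0,\infty)$, $a>0$, $\sigma\in(0,\infty)$,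 and $b$ is not identically zero. The sequence $z$ is defined by $z(0)=1$, $z(n)=\lambda_1\sum_{j=0}^{n-1}b(n-j)z(j)$ for $n\ge 1$ (when $\lambda_1B<1$, these are the power series coefficients of $1/(1-\lambda_1\sum_{j\ge1}b(j)\lambda^j)$ on $|\lambda|\le 1$), and $\Omega=\frac{\sigma}{\lambda_1}\big(\sum_{j=1}^\infty z(j)^2\big)^{1/2}$. A process is (weakly) stationary if it has constant finite mean and $\mathrm{Cov}[X(n),X(n+k)]$ depends only on $k$; $\rho(k)=\mathrm{Cov}[X(n),X(n+k)]$, $k\in\mathbb{Z}$, is its autocovariance function. Known fact (recalled by the paper): if $\lambda_1B<1$ and $\Omega<1$, there is a unique weakly stationary solution $X$ of the ARCH($\infty$) equations; it satisfies $\rho(k)=\mathbb{E}[\nu(0)^2]\sum_{j=0}^\infty z(j)z(j+|k|)$ for $k\in\mathbb{Z}$, with $\mathbb{E}[\nu(0)^2]=\big(\frac{a\sigma}{1-\lambda_1B}\big)^2\frac{1}{1-\Omega^2}$. Weight classes. For finite $r>0$, a real sequence $\gamma=\{\gamma(n)\}_{n\ge0}$ is in $\mathcal{W}(r)$ if $\gamma(n)>0$ for all $n\ge 0$, $\lim_{n\to\infty}\gamma(n-1)/\gamma(n)=1/r$, $\sum_{i=0}^\infty\gamma(i)r^{-i}<\infty$, and $\lim_{m\to\infty}\big(\limsup_{n\to\infty}\frac1{\gamma(n)}\sum_{i=m}^{n-m}\gamma(n-i)\gamma(i)\big)=0$. For $r\in(0,1]$, $\mathcal{W}^{\downarrow}(r)$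 is the set of $g\in\mathcal{W}(r)$ for which there is a non-increasing positive sequence $\gamma=\{\gamma(n)\}_{n\ge 0}$ with $g(n)/\gamma(n)\to1$ as $n\to\infty$. For the sequence $b$, indexed by $j\ge1$, membership in such a class means that $b(n)>0$ for all $n\ge1$ and that the sequence obtained by assigning any positive value to $b(0)$ lies in the class (this does not depend on the value). *)

theory Defs
  imports "HOL-Probability.Probability"
begin

definition covariance :: "'a measure \<Rightarrow> ('a \<Rightarrow> real) \<Rightarrow> ('a \<Rightarrow> real) \<Rightarrow> real" where
  "covariance M U V =
     (\<integral>\<omega>. (U \<omega> - (\<integral>\<omega>. U \<omega> \<partial>M)) * (V \<omega> - (\<integral>\<omega>. V \<omega> \<partial>M)) \<partial>M)"

(* Integrability of the squares says exactly that the variances (lag 0) are finite; by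
   Cauchy-Schwarz all covariances are then finite. *)
definition weakly_stationary :: "'a measure \<Rightarrow> (int \<Rightarrow> 'a \<Rightarrow> real) \<Rightarrow> bool" where
  "weakly_stationary M X \<longleftrightarrow>
     (\<forall>n. X n \<in> borel_measurable M) \<and>
     (\<forall>n. integrable M (X n)) \<and>
     (\<forall>n. integrable M (\<lambda>\<omega>. (X n \<omega>)\<^sup>2)) \<and>
     (\<forall>n m. (\<integral>\<omega>. X n \<omega> \<partial>M) = (\<integral>\<omega>. X m \<omega> \<partial>M)) \<and>
     (\<forall>n m k. covariance M (X n) (X (n + k)) = covariance M (X m) (X (m + k)))"

(* Intended for weakly stationary X, where the choice of base point 0 is immaterial. *)
definition autocovariance :: "'a measure \<Rightarrow> (int \<Rightarrow> 'a \<Rightarrow> real) \<Rightarrow> int \<Rightarrow> real" where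
  "autocovariance M X k = covariance M (X 0) (X k)"

(* Sequences b(1), b(2), ... are functions on nat whose value at 0 is never used;
   a sum over j \<ge> 1 is written as a sum over Suc j. *)
definition arch_coeff_sum :: "(nat \<Rightarrow> real) \<Rightarrow> real" where
  "arch_coeff_sum b = (\<Sum>j. b (Suc j))"

definition arch_volatility ::
  "real \<Rightarrow> (nat \<Rightarrow> real) \<Rightarrow> (int \<Rightarrow> 'a \<Rightarrow> real) \<Rightarrow> int \<Rightarrow> 'a \<Rightarrow> real" where
  "arch_volatility a b X k \<omega> = a + (\<Sum>j. b (Suc j) * X (k - int (Suc j)) \<omega>)"

(* The equations are required almost surely, including convergence of the series. *)
definition arch_solution ::
  "'a measure \<Rightarrow> real \<Rightarrow> (nat \<Rightarrow> real) \<Rightarrow> (int \<Rightarrow> 'a \<Rightarrow> real) \<Rightarrow> (int \<Rightarrow> 'a \<Rightarrow> real) \<Rightarrow> bool" where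
  "arch_solution M a b \<xi> X \<longleftrightarrow>
     (\<forall>k. X k \<in> borel_measurable M) \<and>
     (AE \<omega> in M. \<forall>k. summable (\<lambda>j. b (Suc j) * X (k - int (Suc j)) \<omega>) \<and>
        X k \<omega> = arch_volatility a b X k \<omega> * \<xi> k \<omega>)"

definition arch_nu ::
  "real \<Rightarrow> real \<Rightarrow> (nat \<Rightarrow> real) \<Rightarrow> (int \<Rightarrow> 'a \<Rightarrow> real) \<Rightarrow> int \<Rightarrow> 'a \<Rightarrow> real" where
  "arch_nu lam1 a b X k \<omega> = X k \<omega> - lam1 * arch_volatility a b X k \<omega>"

fun arch_z :: "real \<Rightarrow> (nat \<Rightarrow> real) \<Rightarrow> nat \<Rightarrow> real" where
  "arch_z lam1 b 0 = 1"
| "arch_z lam1 b (Suc n) = lam1 * (\<Sum>j<Suc n. b (Suc n - j) * arch_z lam1 b j)"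

definition arch_Omega :: "real \<Rightarrow> real \<Rightarrow> (nat \<Rightarrow> real) \<Rightarrow> real" where
  "arch_Omega lam1 \<sigma> b = \<sigma> / lam1 * sqrt (\<Sum>j. (arch_z lam1 b (Suc j))\<^sup>2)"

(* The limsup is taken in the extended reals, since it may be infinite for small m. *)
definition weight_class :: "real \<Rightarrow> (nat \<Rightarrow> real) set" where
  "weight_class r = {\<gamma>. r > 0 \<and> (\<forall>n. \<gamma> n > 0) \<and>
     (\<lambda>n. \<gamma> n / \<gamma> (Suc n)) \<longlonglongrightarrow> 1 / r \<and>
     summable (\<lambda>i. \<gamma> i / r ^ i) \<and>
     (\<lambda>m. limsup (\<lambda>n. ereal (1 / \<gamma> n * (\<Sum>i=m..n-m. \<gamma> (n - i) * \<gamma> i)))) \<longlonglongrightarrow> 0}"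

definition weight_class_down :: "real \<Rightarrow> (nat \<Rightarrow> real) set" where
  "weight_class_down r = {g \<in> weight_class r. r \<le> 1 \<and>
     (\<exists>\<gamma>. (\<forall>n. \<gamma> n > 0) \<and> decseq \<gamma> \<and> (\<lambda>n. g n / \<gamma> n) \<longlonglongrightarrow> 1)}"

(* Membership of a sequence indexed by n \<ge> 1: the unused value at 0 is replaced by an
   arbitrary positive number. *)
definition in_class_from1 :: "(nat \<Rightarrow> real) \<Rightarrow> (nat \<Rightarrow> real) set \<Rightarrow> bool" where
  "in_class_from1 b W \<longleftrightarrow> (\<forall>n\<ge>1. b n > 0) \<and> (\<forall>c>0. b(0 := c) \<in> W)"

end

theory Submission
  imports Defs
begin

text \<open>Write \<lambda> for the mean of the noise, \<varsigma>(k) for the volatility and \<nu>(k) = X(k) - \<lambda> \<varsigma>(k) =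
(\<xi>(k) - \<lambda>) \<varsigma>(k). If \<varsigma>(k) depends on the noise before time k only, then \<nu>(k) is orthogonal to
every square-integrable function of that past, and X(k) = \<lambda> a + \<lambda> (b(1) X(k-1) + b(2) X(k-2) + ...) + \<nu>(k)
is a linear recursion driven by an orthogonal sequence. Multiplying it by \<nu>(0) gives
E[X(k) \<nu>(0)] = v z(k) for k \<ge> 0, with v = E[\<nu>(0)^2] (lemma \<open>nu_X_cross\<close>), and multiplying the equation for X(0) by
X(k) gives \<rho>(k) = v z(k) + \<lambda> (b(1) \<rho>(k+1) + b(2) \<rho>(k+2) + ...). Because \<lambda> B < 1, this recursion has
only one bounded solution on k \<ge> 0, namely \<rho>(k) = v (z(0) z(k) + z(1) z(k+1) + ...) (lemma \<open>autocovariance_formula\<close>).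

The sequence z solves a renewal equation with kernel \<lambda> b. In a convolution of two sequences of order
b(n) only those terms matter asymptotically in which one of the two indices stays bounded; this is the defining
property of the weight class. Hence z(n) / b(n) tends to \<lambda> / (1 - \<lambda> B)^2 (lemma \<open>renewal_limit\<close>).
Since b is asymptotically non-increasing, z(j+n) is at most a constant times b(n) for all j, and dominated
convergence yields \<rho>(n) / b(n) \<longlonglongrightarrow> v \<lambda> (1 - \<lambda> B)^(-3). The sum of \<rho> over the integers is
v (z(0) + z(1) + ...)^2 = v (1 - \<lambda> B)^(-2), which gives the first form of the limit.

The delicate point is the dependence of \<varsigma>(k) on the past noise only: a weakly stationary solution
might look into the future. Iterating the equations expresses X(k) by the noise in a
window before k, up to a remainder in which earlier values of X are multiplied by path weights W(m), sums over all
paths from k to k-m of products of coefficients and noise. By the Cauchy-Schwarz inequality the remainder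
tends to zero in mean, whatever the joint law of X and the noise, as soon as the L2 norms of the path weights are
summable (lemma \<open>X_series_L1\<close>). Their second moments u(m) solve a renewal equation whose kernel
(\<sigma>/\<lambda>)^2 z(j)^2 has total mass \<Omega>^2 < 1 and is of order b(j)^2. As b^2 belongs to the weight
class together with b, u(m) is of order b(m)^2 (lemma \<open>renewal_bounded\<close>), so the norms are of order b(m), hence
summable.\<close>

section \<open>Subexponential weight sequences\<close>

text \<open>The iterated limit is used only in this form: from some cut-off on, the middle part of the convolution
square is eventually at most an arbitrarily small fraction of \<gamma>(n). The terms are non-negative, so an upper bound
on the limit superior is all that convergence to zero requires.\<close>
lemma weight_class_1_iff:
  "\<gamma> \<in> weight_class 1 \<longleftrightarrow>
     (\<forall>n. \<gamma> n > 0) \<and> (\<lambda>n. \<gamma> n / \<gamma> (Suc n)) \<longlonglongrightarrow> 1 \<and> summable \<gamma> \<and>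
     (\<forall>\<epsilon>>0. \<exists>m0. \<forall>m\<ge>m0. \<forall>\<^sub>F n in sequentially. (\<Sum>i=m..n-m. \<gamma> (n - i) * \<gamma> i) \<le> \<epsilon> * \<gamma> n)"
proof (cases "\<forall>n. \<gamma> n > 0")
  case True
  define F where "F m n = (\<Sum>i=m..n-m. \<gamma> (n - i) * \<gamma> i) / \<gamma> n" for m n
  define L where "L m = limsup (\<lambda>n. ereal (F m n))" for m
  have F_le_iff: "F m n \<le> \<epsilon> \<longleftrightarrow> (\<Sum>i=m..n-m. \<gamma> (n - i) * \<gamma> i) \<le> \<epsilon> * \<gamma> n" for m n \<epsilon>
    using True by (simp add: F_def pos_divide_le_eq)
  have F_nonneg: "0 \<le> F m n" for m n
    using True unfolding F_def by (intro divide_nonneg_pos mult_nonneg_nonneg sum_nonneg) (auto intro: less_imp_le)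
  have L_nonneg: "0 \<le> L m" for m
    unfolding L_def by (rule le_Limsup) (auto simp: F_nonneg)
  have middle_iff: "L \<longlonglongrightarrow> 0 \<longleftrightarrow> (\<forall>\<epsilon>>0. \<exists>m0. \<forall>m\<ge>m0. \<forall>\<^sub>F n in sequentially. F m n \<le> \<epsilon>)"
  proof
    assume lim: "L \<longlonglongrightarrow> 0"
    show "\<forall>\<epsilon>>0. \<exists>m0. \<forall>m\<ge>m0. \<forall>\<^sub>F n in sequentially. F m n \<le> \<epsilon>"
    proof (intro allI impI)
      fix \<epsilon> :: real assume "\<epsilon> > 0"
      then have "\<forall>\<^sub>F m in sequentially. L m < ereal \<epsilon>"
        using order_tendstoD(2)[OF lim, of "ereal \<epsilon>"] by simp
      then obtain m0 where m0: "\<And>m. m \<ge> m0 \<Longrightarrow> L m < ereal \<epsilon>"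
        by (auto simp: eventually_sequentially)
      have "\<forall>\<^sub>F n in sequentially. F m n \<le> \<epsilon>" if "m \<ge> m0" for m
        using Limsup_lessD[of sequentially "\<lambda>n. ereal (F m n)" "ereal \<epsilon>"] m0[OF that]
        unfolding L_def by (auto elim: eventually_mono)
      then show "\<exists>m0. \<forall>m\<ge>m0. \<forall>\<^sub>F n in sequentially. F m n \<le> \<epsilon>" by blast
    qed
  next
    assume *: "\<forall>\<epsilon>>0. \<exists>m0. \<forall>m\<ge>m0. \<forall>\<^sub>F n in sequentially. F m n \<le> \<epsilon>"
    show "L \<longlonglongrightarrow> 0"
    proof (rule order_tendstoI)
      fix c :: ereal assume "c < 0"
      then show "\<forall>\<^sub>F m in sequentially. c < L m"
        by (intro always_eventually allI less_le_trans[OF _ L_nonneg])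
    next
      fix c :: ereal assume "0 < c"
      then obtain \<epsilon> where \<epsilon>: "\<epsilon> > 0" "ereal \<epsilon> < c"
        using ereal_dense2[of 0 c] by auto
      with * obtain m0 where m0: "\<And>m. m \<ge> m0 \<Longrightarrow> \<forall>\<^sub>F n in sequentially. F m n \<le> \<epsilon>"
        by blast
      have "L m \<le> ereal \<epsilon>" if "m \<ge> m0" for m
        unfolding L_def by (rule Limsup_bounded) (use m0[OF that] in \<open>auto elim: eventually_mono\<close>)
      then show "\<forall>\<^sub>F m in sequentially. L m < c"
        using \<epsilon>(2) by (auto simp: eventually_sequentially intro: le_less_trans)
    qed
  qed
  show ?thesis
    using True by (simp add: weight_class_def middle_iff[unfolded F_le_iff, unfolded L_def F_def])
next
  case False
  then show ?thesis unfolding weight_class_def by blast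
qed

lemma weight_class_1I:
  assumes "\<And>n. \<gamma> n > 0" "(\<lambda>n. \<gamma> n / \<gamma> (Suc n)) \<longlonglongrightarrow> 1" "summable \<gamma>"
    and "\<And>\<epsilon>. \<epsilon> > 0 \<Longrightarrow> \<exists>m0. \<forall>m\<ge>m0. \<forall>\<^sub>F n in sequentially.
            (\<Sum>i=m..n-m. \<gamma> (n - i) * \<gamma> i) \<le> \<epsilon> * \<gamma> n"
  shows "\<gamma> \<in> weight_class 1"
  using assms by (simp add: weight_class_1_iff)

lemma weight_class_1D:
  assumes "\<gamma> \<in> weight_class 1"
  shows weight_class_pos: "\<gamma> n > 0"
    and weight_class_ratio: "(\<lambda>n. \<gamma> n / \<gamma> (Suc n)) \<longlonglongrightarrow> 1"
    and weight_class_summable: "summable \<gamma>"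
    and weight_class_middle: "\<epsilon> > 0 \<Longrightarrow> \<exists>m0. \<forall>m\<ge>m0. \<forall>\<^sub>F n in sequentially.
            (\<Sum>i=m..n-m. \<gamma> (n - i) * \<gamma> i) \<le> \<epsilon> * \<gamma> n"
  using assms by (auto simp: weight_class_1_iff)

lemma weight_class_shift:
  assumes "\<gamma> \<in> weight_class 1"
  shows "(\<lambda>n. \<gamma> (n - j) / \<gamma> n) \<longlonglongrightarrow> 1"
proof -
  note pos = weight_class_pos[OF assms]
  have "(\<lambda>n. \<gamma> n / \<gamma> (n + j)) \<longlonglongrightarrow> 1"
  proof (induction j)
    case 0
    have "(\<lambda>n. \<gamma> n / \<gamma> (n + 0)) = (\<lambda>n. 1)" using pos by (auto simp: less_imp_neq[symmetric])
    then show ?case by simp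
  next
    case (Suc j)
    have "(\<lambda>n. \<gamma> n / \<gamma> (n + j) * (\<gamma> (n + j) / \<gamma> (Suc (n + j)))) \<longlonglongrightarrow> 1 * 1"
      by (intro tendsto_mult Suc LIMSEQ_ignore_initial_segment[OF weight_class_ratio[OF assms], simplified])
    moreover have "\<gamma> n / \<gamma> (n + j) * (\<gamma> (n + j) / \<gamma> (Suc (n + j))) = \<gamma> n / \<gamma> (n + Suc j)" for n
      using pos[of "n + j"] by simp
    ultimately show ?case by (simp only: mult_1_right)
  qed
  then show ?thesis
    by (intro LIMSEQ_offset[where k = j and f = "\<lambda>n. \<gamma> (n - j) / \<gamma> n"]) simp
qed

text \<open>A sum of squares of non-negative numbers is at most the square of their sum, so the middle part of the
convolution for the squared sequence is at most the square of the middle part for \<gamma>. This brings second moments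
within reach of the renewal lemmas.\<close>
lemma weight_class_sqr:
  assumes "\<gamma> \<in> weight_class 1"
  shows "(\<lambda>n. (\<gamma> n)\<^sup>2) \<in> weight_class 1"
proof (rule weight_class_1I)
  note pos = weight_class_pos[OF assms]
  show "(\<gamma> n)\<^sup>2 > 0" for n using pos[of n] by simp
  show "(\<lambda>n. (\<gamma> n)\<^sup>2 / (\<gamma> (Suc n))\<^sup>2) \<longlonglongrightarrow> 1"
    using tendsto_power[OF weight_class_ratio[OF assms], of 2] by (simp add: power_divide)
  show "summable (\<lambda>n. (\<gamma> n)\<^sup>2)"
  proof (rule summable_comparison_test_ev)
    have "\<forall>\<^sub>F n in sequentially. \<gamma> n < 1"
      using order_tendstoD(2)[OF summable_LIMSEQ_zero[OF weight_class_summable[OF assms]], of 1] by simp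
    then show "\<forall>\<^sub>F n in sequentially. norm ((\<gamma> n)\<^sup>2) \<le> \<gamma> n"
    proof eventually_elim
      case (elim n)
      then show ?case using pos[of n] by (simp add: power2_eq_square mult_left_le)
    qed
    show "summable \<gamma>" by (rule weight_class_summable[OF assms])
  qed
  fix \<epsilon> :: real assume "\<epsilon> > 0"
  then obtain m0 where m0: "\<And>m. m \<ge> m0 \<Longrightarrow> \<forall>\<^sub>F n in sequentially.
      (\<Sum>i=m..n-m. \<gamma> (n - i) * \<gamma> i) \<le> sqrt \<epsilon> * \<gamma> n"
    using weight_class_middle[OF assms, of "sqrt \<epsilon>"] by auto
  have "\<forall>\<^sub>F n in sequentially. (\<Sum>i=m..n-m. (\<gamma> (n - i))\<^sup>2 * (\<gamma> i)\<^sup>2) \<le> \<epsilon> * (\<gamma> n)\<^sup>2"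
    if "m \<ge> m0" for m
    using m0[OF that]
  proof eventually_elim
    case (elim n)
    let ?g = "\<lambda>i. \<gamma> (n - i) * \<gamma> i"
    have g: "0 \<le> ?g i" for i using pos by (simp add: less_imp_le)
    have "(\<Sum>i=m..n-m. (?g i)\<^sup>2) \<le> (\<Sum>i=m..n-m. ?g i * (\<Sum>i=m..n-m. ?g i))"
      unfolding power2_eq_square
      by (intro sum_mono mult_left_mono member_le_sum g) auto
    also have "\<dots> = (\<Sum>i=m..n-m. ?g i)\<^sup>2"
      by (simp add: power2_eq_square sum_distrib_right)
    also have "\<dots> \<le> (sqrt \<epsilon> * \<gamma> n)\<^sup>2"
      by (intro power_mono elim sum_nonneg g)
    also have "\<dots> = \<epsilon> * (\<gamma> n)\<^sup>2" using \<open>\<epsilon> > 0\<close> by (simp add: power_mult_distrib)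
    finally show ?case by (simp add: power_mult_distrib)
  qed
  then show "\<exists>m0. \<forall>m\<ge>m0. \<forall>\<^sub>F n in sequentially.
      (\<Sum>i=m..n-m. (\<gamma> (n - i))\<^sup>2 * (\<gamma> i)\<^sup>2) \<le> \<epsilon> * (\<gamma> n)\<^sup>2" by blast
qed

text \<open>Far out, h and g differ by factors close to c. The middle part of the convolution contains only indices
far out, so it changes by a bounded factor.\<close>
lemma weight_class_asymp:
  assumes g: "g \<in> weight_class 1" and pos: "\<And>n. h n > 0"
    and lim: "(\<lambda>n. h n / g n) \<longlonglongrightarrow> c" and "c > 0"
  shows "h \<in> weight_class 1"
proof (rule weight_class_1I)
  note gpos = weight_class_pos[OF g]
  have gne: "g n \<noteq> 0" for n using gpos[of n] by simp
  show "h n > 0" for n by (rule pos)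
  have "(\<lambda>n. h n / g n * (g n / g (Suc n)) / (h (Suc n) / g (Suc n))) \<longlonglongrightarrow> c * 1 / c"
    by (intro tendsto_divide tendsto_mult lim LIMSEQ_Suc[OF lim] weight_class_ratio[OF g])
       (use \<open>c > 0\<close> in auto)
  moreover have "h n / g n * (g n / g (Suc n)) / (h (Suc n) / g (Suc n)) = h n / h (Suc n)" for n
    using gne[of n] gne[of "Suc n"] by simp
  ultimately show "(\<lambda>n. h n / h (Suc n)) \<longlonglongrightarrow> 1"
    using \<open>c > 0\<close> by (simp only:) simp
  have "\<forall>\<^sub>F n in sequentially. h n / g n < 2 * c \<and> c / 2 < h n / g n"
    using \<open>c > 0\<close> by (intro eventually_conj order_tendstoD[OF lim]) auto
  then obtain N where "\<forall>n\<ge>N. h n / g n < 2 * c \<and> c / 2 < h n / g n"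
    by (auto simp: eventually_sequentially)
  then have N: "h n \<le> 2 * c * g n" "c / 2 * g n \<le> h n" if "n \<ge> N" for n
    using that gpos[of n] by (force simp: pos_divide_less_eq pos_less_divide_eq)+
  show "summable h"
  proof (rule summable_comparison_test_ev)
    show "\<forall>\<^sub>F n in sequentially. norm (h n) \<le> 2 * c * g n"
      using N(1) pos by (auto simp: eventually_sequentially less_imp_le)
    show "summable (\<lambda>n. 2 * c * g n)"
      by (intro summable_mult weight_class_summable[OF g])
  qed
  fix \<epsilon> :: real assume "\<epsilon> > 0"
  define \<delta> where "\<delta> = \<epsilon> / (8 * c)"
  have "\<delta> > 0" using \<open>\<epsilon> > 0\<close> \<open>c > 0\<close> by (simp add: \<delta>_def)
  then obtain m0 where m0: "\<And>m. m \<ge> m0 \<Longrightarrow> \<forall>\<^sub>F n in sequentially.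
      (\<Sum>i=m..n-m. g (n - i) * g i) \<le> \<delta> * g n"
    using weight_class_middle[OF g] by blast
  have "\<forall>\<^sub>F n in sequentially. (\<Sum>i=m..n-m. h (n - i) * h i) \<le> \<epsilon> * h n"
    if m: "m \<ge> max m0 N" for m
    using m0[OF max.cobounded1[THEN order_trans, OF m]] eventually_ge_at_top[of "N + m"]
  proof eventually_elim
    case (elim n)
    have "(\<Sum>i=m..n-m. h (n - i) * h i) \<le> (\<Sum>i=m..n-m. (2 * c * g (n - i)) * (2 * c * g i))"
      by (intro sum_mono mult_mono N) (use m elim gpos pos \<open>c > 0\<close> in \<open>auto simp: less_imp_le\<close>)
    also have "\<dots> = 4 * c\<^sup>2 * (\<Sum>i=m..n-m. g (n - i) * g i)"
      by (simp add: sum_distrib_left power2_eq_square mult_ac)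
    also have "\<dots> \<le> 4 * c\<^sup>2 * (\<delta> * g n)"
      by (intro mult_left_mono elim) auto
    also have "\<dots> = \<epsilon> * (c / 2 * g n)"
      using \<open>c > 0\<close> by (simp add: \<delta>_def power2_eq_square)
    also have "\<dots> \<le> \<epsilon> * h n"
      by (intro mult_left_mono N) (use elim \<open>\<epsilon> > 0\<close> in auto)
    finally show ?case .
  qed
  then show "\<exists>m0. \<forall>m\<ge>m0. \<forall>\<^sub>F n in sequentially. (\<Sum>i=m..n-m. h (n - i) * h i) \<le> \<epsilon> * h n"
    by blast
qed

lemma weight_class_down_asymp:
  assumes g: "g \<in> weight_class_down 1" and pos: "\<And>n. h n > 0"
    and lim: "(\<lambda>n. h n / g n) \<longlonglongrightarrow> c" and "c > 0"
  shows "h \<in> weight_class_down 1"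
proof -
  from g obtain \<gamma> where \<gamma>: "\<And>n. \<gamma> n > 0" "decseq \<gamma>" "(\<lambda>n. g n / \<gamma> n) \<longlonglongrightarrow> 1"
    and g1: "g \<in> weight_class 1"
    by (auto simp: weight_class_down_def)
  have "(\<lambda>n. (h n / g n) * (g n / \<gamma> n) / c) \<longlonglongrightarrow> c * 1 / c"
    using \<open>c > 0\<close> by (intro tendsto_intros lim \<gamma>) auto
  moreover have "(h n / g n) * (g n / \<gamma> n) / c = h n / (c * \<gamma> n)" for n
    using weight_class_pos[OF g1, of n] by simp
  ultimately have "(\<lambda>n. h n / (c * \<gamma> n)) \<longlonglongrightarrow> 1"
    using \<open>c > 0\<close> by simp
  moreover have "decseq (\<lambda>n. c * \<gamma> n)"
    using \<gamma>(2) \<open>c > 0\<close> by (simp add: decseq_def)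
  ultimately show ?thesis
    using weight_class_asymp[OF g1 pos lim \<open>c > 0\<close>] \<gamma>(1) \<open>c > 0\<close>
    by (auto simp: weight_class_down_def intro!: exI[of _ "\<lambda>n. c * \<gamma> n"])
qed

text \<open>Replace g by the non-increasing sequence asymptotic to it, use monotonicity, and go back. The constant
provides the dominating function when correlations of the sequence are summed.\<close>
lemma weight_class_down_quasi_decreasing:
  assumes g: "g \<in> weight_class_down 1"
  obtains C where "C > 0" "\<And>i n. n \<le> i \<Longrightarrow> g i \<le> C * g n"
proof -
  from g obtain \<gamma> where \<gamma>: "\<And>n. \<gamma> n > 0" "decseq \<gamma>" "(\<lambda>n. g n / \<gamma> n) \<longlonglongrightarrow> 1"
    and g1: "g \<in> weight_class 1"
    by (auto simp: weight_class_down_def)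
  note gpos = weight_class_pos[OF g1]
  have "(\<lambda>n. inverse (g n / \<gamma> n)) \<longlonglongrightarrow> inverse 1"
    by (intro tendsto_inverse \<gamma>) auto
  then have "Bseq (\<lambda>n. inverse (g n / \<gamma> n))" "Bseq (\<lambda>n. g n / \<gamma> n)"
    using \<gamma>(3) by (blast intro: convergent_imp_Bseq convergentI)+
  then obtain K1 K2 where K: "K1 > 0" "K2 > 0" "\<And>n. norm (inverse (g n / \<gamma> n)) \<le> K1"
      "\<And>n. norm (g n / \<gamma> n) \<le> K2"
    by (meson BseqE)
  have K1: "\<gamma> n \<le> K1 * g n" and K2: "g n \<le> K2 * \<gamma> n" for n
    using K(3)[of n] K(4)[of n] gpos[of n] \<gamma>(1)[of n] by (auto simp: field_simps)
  show ?thesis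
  proof (rule that[of "K2 * K1"])
    show "K2 * K1 > 0" using K by simp
    fix n i :: nat assume "n \<le> i"
    have "g i \<le> K2 * \<gamma> i" by (rule K2)
    also have "\<dots> \<le> K2 * \<gamma> n"
      using \<gamma>(2) \<open>n \<le> i\<close> K by (simp add: decseq_def)
    also have "\<dots> \<le> K2 * (K1 * g n)"
      using K K1 by simp
    finally show "g i \<le> K2 * K1 * g n" by (simp add: mult_ac)
  qed
qed

section \<open>Renewal equations with subexponential kernels\<close>

text \<open>For a convolution of two sequences of order \<gamma>, the first and the last of these three ranges carry the
asymptotics, and the middle one is negligible by the definition of the weight class.\<close>
lemma convolution_split:
  fixes f :: "nat \<Rightarrow> 'a::comm_monoid_add"
  assumes "0 < L" "2 * L \<le> n"
  shows "(\<Sum>j<n. f j) = (\<Sum>j<L. f j) + (\<Sum>j=L..n-L. f j) + (\<Sum>i=1..<L. f (n - i))"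
proof -
  have "{..<n} = ({..<L} \<union> {L..n-L}) \<union> {Suc (n - L)..<n}"
    using assms by auto
  then have "(\<Sum>j<n. f j) = sum f (({..<L} \<union> {L..n-L}) \<union> {Suc (n - L)..<n})" by (rule arg_cong)
  also have "\<dots> = sum f ({..<L} \<union> {L..n-L}) + (\<Sum>j=Suc (n - L)..<n. f j)"
    by (rule sum.union_disjoint) (use assms in auto)
  also have "sum f ({..<L} \<union> {L..n-L}) = (\<Sum>j<L. f j) + (\<Sum>j=L..n-L. f j)"
    by (rule sum.union_disjoint) auto
  also have "(\<Sum>j=Suc (n - L)..<n. f j) = (\<Sum>i=1..<L. f (n - i))"
    by (rule sum.reindex_bij_witness[of _ "\<lambda>i. n - i" "\<lambda>i. n - i"]) (use assms in auto)
  finally show ?thesis .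
qed

text \<open>Summing the equation over n < N bounds the partial sums U by F + S U, where F and S are the sums of f and of the
kernel. Once u is summable, the Cauchy product turns this into an equality.\<close>
lemma renewal_summable:
  fixes k f u :: "nat \<Rightarrow> real"
  assumes k: "\<And>j. k (Suc j) \<ge> 0" "summable (\<lambda>j. k (Suc j))" "(\<Sum>j. k (Suc j)) < 1"
    and f: "\<And>n. f n \<ge> 0" "summable f"
    and u: "\<And>n. u n \<ge> 0" "\<And>n. u n = f n + (\<Sum>j<n. k (n - j) * u j)"
  shows "summable u" and "suminf u = suminf f / (1 - (\<Sum>j. k (Suc j)))"
proof -
  define S where "S = (\<Sum>j. k (Suc j))"
  \<comment> \<open>The kernel is continued by 0 at 0, which makes the sum a full convolution.\<close>
  define k0 where "k0 j = (case j of 0 \<Rightarrow> 0 | Suc i \<Rightarrow> k (Suc i))" for j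
  have "(\<lambda>j. k0 (Suc j)) sums S"
    using k(2) by (simp add: k0_def S_def summable_sums)
  then have k0_sums: "k0 sums S"
    by (simp add: sums_Suc_iff) (simp add: k0_def)
  have k0_nonneg: "k0 j \<ge> 0" for j using k(1) by (simp add: k0_def split: nat.split)
  have conv: "(\<Sum>j<n. k (n - j) * u j) = (\<Sum>j\<le>n. u j * k0 (n - j))" for n
  proof -
    have "(\<Sum>j\<le>n. u j * k0 (n - j)) = (\<Sum>j<n. u j * k0 (n - j))"
      by (simp add: k0_def lessThan_Suc_atMost[symmetric])
    also have "\<dots> = (\<Sum>j<n. k (n - j) * u j)"
      by (rule sum.cong) (auto simp: k0_def mult.commute split: nat.split)
    finally show ?thesis ..
  qed
  have u_conv: "u n = f n + (\<Sum>j\<le>n. u j * k0 (n - j))" for n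
    unfolding conv[symmetric] by (rule u(2))
  have bound: "(\<Sum>n<N. u n) \<le> suminf f / (1 - S)" for N
  proof -
    have "(\<Sum>n<N. \<Sum>j\<le>n. u j * k0 (n - j)) = (\<Sum>(n,j)\<in>(SIGMA n:{..<N}. {..n}). u j * k0 (n - j))"
      by (simp add: sum.Sigma)
    also have "\<dots> = (\<Sum>(j,i)\<in>(SIGMA j:{..<N}. {..<N-j}). u j * k0 i)"
      by (rule sum.reindex_bij_witness[of _ "\<lambda>(j,i). (j + i, j)" "\<lambda>(n,j). (j, n - j)"]) auto
    also have "\<dots> = (\<Sum>j<N. u j * (\<Sum>i<N-j. k0 i))"
      by (simp add: sum.Sigma sum_distrib_left)
    also have "\<dots> \<le> (\<Sum>j<N. u j * S)"
    proof (intro sum_mono mult_left_mono u(1))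
      fix j show "(\<Sum>i<N-j. k0 i) \<le> S"
        using sum_le_suminf[of k0 "{..<N-j}"] k0_nonneg k0_sums by (simp add: sums_iff)
    qed
    finally have "(\<Sum>n<N. \<Sum>j\<le>n. u j * k0 (n - j)) \<le> (\<Sum>n<N. u n) * S"
      by (simp add: sum_distrib_right)
    moreover have "(\<Sum>n<N. f n) \<le> suminf f"
      using f by (intro sum_le_suminf) auto
    moreover have "(\<Sum>n<N. u n) = (\<Sum>n<N. f n) + (\<Sum>n<N. \<Sum>j\<le>n. u j * k0 (n - j))"
      unfolding sum.distrib[symmetric] using u_conv by (rule sum.cong[OF refl])
    ultimately have "(\<Sum>n<N. u n) * (1 - S) \<le> suminf f"
      by (simp add: algebra_simps)
    then show ?thesis using k(3) by (simp add: S_def pos_le_divide_eq)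
  qed
  show su: "summable u"
    by (rule summableI_nonneg_bounded[OF u(1) bound])
  have "(\<lambda>n. \<Sum>j\<le>n. u j * k0 (n - j)) sums (suminf u * S)"
    using Cauchy_product_sums[of u k0] su k0_sums u(1) k0_nonneg by (simp add: sums_iff)
  from sums_add[OF summable_sums[OF f(2)] this]
  have "(\<lambda>n. f n + (\<Sum>j\<le>n. u j * k0 (n - j))) sums (suminf f + suminf u * S)" .
  then have "u sums (suminf f + suminf u * S)" by (subst (asm) u_conv[symmetric])
  then have "suminf u = suminf f + suminf u * S"
    by (simp add: sums_iff)
  then have "suminf u * (1 - S) = suminf f" by (simp add: algebra_simps)
  then show "suminf u = suminf f / (1 - (\<Sum>j. k (Suc j)))"
    using k(3) by (simp add: S_def eq_divide_eq)
qed

lemma pos_seq_bounded_prefix: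
  fixes u \<gamma> :: "nat \<Rightarrow> real"
  assumes "\<And>n. \<gamma> n > 0"
  obtains K where "K \<ge> K0" "\<And>n. n < N \<Longrightarrow> u n \<le> K * \<gamma> n"
proof
  let ?K = "Max (insert K0 ((\<lambda>n. u n / \<gamma> n) ` {..<N}))"
  show "?K \<ge> K0" by simp
  fix n assume "n < N"
  then have "u n / \<gamma> n \<le> ?K" by (intro Max_ge) auto
  then show "u n \<le> ?K * \<gamma> n" using assms[of n] by (simp add: pos_divide_le_eq)
qed

text \<open>Strong induction with hypothesis u \<le> K \<gamma>. In the convolution, small j contribute a multiple of
\<gamma>(n) that does not involve K, because u is summable and \<gamma>(n-j) is close to \<gamma>(n); the middle
contributes at most C K \<epsilon> \<gamma>(n); and large j contribute at most K (1 + \<epsilon>) S \<gamma>(n), with S < 1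
the mass of the kernel. For small \<epsilon> the coefficients of K add up to less than 1, and a large K
absorbs the rest.\<close>
lemma renewal_bounded:
  fixes k f u \<gamma> :: "nat \<Rightarrow> real"
  assumes \<gamma>: "\<gamma> \<in> weight_class 1"
    and k: "\<And>j. k (Suc j) \<ge> 0" "\<And>j. k (Suc j) \<le> C * \<gamma> (Suc j)" "(\<Sum>j. k (Suc j)) < 1"
    and f: "\<And>n. f n \<ge> 0" "\<And>n. f n \<le> F * \<gamma> n"
    and u: "\<And>n. u n \<ge> 0" "\<And>n. u n = f n + (\<Sum>j<n. k (n - j) * u j)"
  obtains K where "K > 0" "\<And>n. u n \<le> K * \<gamma> n"
proof -
  note pos = weight_class_pos[OF \<gamma>] and sm = weight_class_summable[OF \<gamma>]
  define S where "S = (\<Sum>j. k (Suc j))"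
  have "0 \<le> C * \<gamma> (Suc 0)" using k(1)[of 0] k(2)[of 0] by linarith
  then have C: "C \<ge> 0" using pos[of "Suc 0"] by (simp add: zero_le_mult_iff)
  have ks: "summable (\<lambda>j. k (Suc j))"
    by (rule summable_comparison_test[of _ "\<lambda>j. C * \<gamma> (Suc j)"])
       (use k sm in \<open>auto intro!: summable_mult simp: summable_Suc_iff\<close>)
  have fs: "summable f"
    by (rule summable_comparison_test[of _ "\<lambda>j. F * \<gamma> j"])
       (use f sm in \<open>auto intro!: summable_mult\<close>)
  have us: "summable u" by (rule renewal_summable(1)[where k = k and f = f and u = u, OF k(1) ks k(3) f(1) fs u])
  define U where "U = suminf u"
  have U: "U \<ge> 0" unfolding U_def by (rule suminf_nonneg[OF us u(1)])
  have S: "0 \<le> S" "S < 1" unfolding S_def using k suminf_nonneg[OF ks] by auto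
  \<comment> \<open>With this choice the coefficients of K sum to at most \<open>S + \<epsilon> * (C + 1) = (1 + S) / 2\<close>.\<close>
  define \<epsilon> where "\<epsilon> = (1 - S) / (2 * (C + 1))"
  have \<epsilon>: "\<epsilon> > 0" "\<epsilon> * (C + 1) = (1 - S) / 2" using S C by (auto simp: \<epsilon>_def field_simps)
  obtain m0 where m0: "\<And>m. m \<ge> m0 \<Longrightarrow> \<forall>\<^sub>F n in sequentially.
      (\<Sum>i=m..n-m. \<gamma> (n - i) * \<gamma> i) \<le> \<epsilon> * \<gamma> n"
    using weight_class_middle[OF \<gamma> \<epsilon>(1)] by blast
  define L where "L = Suc m0"
  have "\<forall>\<^sub>F n in sequentially. \<gamma> (n - i) / \<gamma> n < 1 + \<epsilon>" for i
    using \<epsilon>(1) by (intro order_tendstoD(2)[OF weight_class_shift[OF \<gamma>]]) auto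
  then have "\<forall>\<^sub>F n in sequentially. \<forall>i\<in>{..<L}. \<gamma> (n - i) / \<gamma> n < 1 + \<epsilon>"
    by (simp add: eventually_ball_finite_distrib)
  moreover have "m0 \<le> L" by (simp add: L_def)
  ultimately have "\<forall>\<^sub>F n in sequentially. (\<Sum>i=L..n-L. \<gamma> (n - i) * \<gamma> i) \<le> \<epsilon> * \<gamma> n \<and>
      (\<forall>i\<in>{..<L}. \<gamma> (n - i) / \<gamma> n < 1 + \<epsilon>)"
    using m0 by (intro eventually_conj)
  then obtain N where N': "\<forall>n\<ge>N. (\<Sum>i=L..n-L. \<gamma> (n - i) * \<gamma> i) \<le> \<epsilon> * \<gamma> n \<and>
      (\<forall>i\<in>{..<L}. \<gamma> (n - i) / \<gamma> n < 1 + \<epsilon>)"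
    unfolding eventually_sequentially by blast
  have N: "(\<Sum>i=L..n-L. \<gamma> (n - i) * \<gamma> i) \<le> \<epsilon> * \<gamma> n"
    "\<And>i. i < L \<Longrightarrow> \<gamma> (n - i) \<le> (1 + \<epsilon>) * \<gamma> n" if "n \<ge> N" for n
    using N' that pos[of n] by (force simp: pos_divide_less_eq)+
  \<comment> \<open>Any K above this value absorbs the contributions of the source and of the first range.\<close>
  define K0 where "K0 = (F + C * (1 + \<epsilon>) * U) / ((1 - S) / 2) + 1"
  have "0 \<le> F * \<gamma> 0" using f[of 0] by linarith
  then have F: "F \<ge> 0" using pos[of 0] by (simp add: zero_le_mult_iff)
  obtain K where K: "K \<ge> K0" "\<And>n. n < N + 2 * L \<Longrightarrow> u n \<le> K * \<gamma> n"
    using pos_seq_bounded_prefix[of \<gamma> K0 "N + 2 * L" u] pos by blast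
  have "K0 > 0" unfolding K0_def using F C U S \<epsilon> by (intro add_nonneg_pos divide_nonneg_pos) auto
  with K have Kpos: "K > 0" by simp
  have K0: "F + C * (1 + \<epsilon>) * U \<le> K * ((1 - S) / 2)"
  proof -
    have "A \<le> (A / q + 1) * q" if "q > 0" for A q :: real
      using that by (simp add: distrib_right)
    then have "F + C * (1 + \<epsilon>) * U \<le> K0 * ((1 - S) / 2)"
      unfolding K0_def using S by simp
    also have "\<dots> \<le> K * ((1 - S) / 2)" using S K by (intro mult_right_mono) auto
    finally show ?thesis .
  qed
  have "u n \<le> K * \<gamma> n" for n
  proof (induction n rule: less_induct)
    case (less n)
    show ?case
    proof (cases "n < N + 2 * L")
      case False
      have kC: "k i \<le> C * \<gamma> i" and k0: "k i \<ge> 0" if "0 < i" for i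
        using k(1)[of "i - 1"] k(2)[of "i - 1"] that by auto
      have "u n = f n + ((\<Sum>j<L. k (n - j) * u j) + (\<Sum>j=L..n-L. k (n - j) * u j)
          + (\<Sum>i=1..<L. k (n - (n - i)) * u (n - i)))"
        using False by (subst u(2), subst convolution_split[of L]) (auto simp: L_def)
      also have "\<dots> \<le> F * \<gamma> n + ((\<Sum>j<L. C * (1 + \<epsilon>) * \<gamma> n * u j)
          + (\<Sum>j=L..n-L. C * K * (\<gamma> (n - j) * \<gamma> j)) + (\<Sum>i=1..<L. K * (1 + \<epsilon>) * \<gamma> n * k i))"
      proof (intro add_mono sum_mono f)
        fix j assume j: "j \<in> {..<L}"
        have "k (n - j) \<le> C * \<gamma> (n - j)" using j False by (intro kC) auto
        also have "\<dots> \<le> C * ((1 + \<epsilon>) * \<gamma> n)" using j False C by (intro mult_left_mono N) auto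
        finally show "k (n - j) * u j \<le> C * (1 + \<epsilon>) * \<gamma> n * u j"
          using u(1)[of j] by (intro mult_right_mono) (auto simp: mult_ac)
      next
        fix j assume j: "j \<in> {L..n-L}"
        then have "j < n" using False by (auto simp: L_def)
        then have "k (n - j) * u j \<le> (C * \<gamma> (n - j)) * (K * \<gamma> j)"
          using C pos[of "n - j"] by (intro mult_mono kC less u) auto
        then show "k (n - j) * u j \<le> C * K * (\<gamma> (n - j) * \<gamma> j)" by (simp add: mult_ac)
      next
        fix i assume i: "i \<in> {1..<L}"
        have "u (n - i) \<le> K * \<gamma> (n - i)" using i False by (intro less) auto
        also have "\<dots> \<le> K * ((1 + \<epsilon>) * \<gamma> n)" using i False Kpos by (intro mult_left_mono N) auto
        finally have "k i * u (n - i) \<le> k i * (K * ((1 + \<epsilon>) * \<gamma> n))"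
          using i by (intro mult_left_mono k0) auto
        then show "k (n - (n - i)) * u (n - i) \<le> K * (1 + \<epsilon>) * \<gamma> n * k i"
          using i False by (simp add: mult_ac)
      qed
      also have "\<dots> = F * \<gamma> n + (C * (1 + \<epsilon>) * \<gamma> n * (\<Sum>j<L. u j)
          + C * K * (\<Sum>j=L..n-L. \<gamma> (n - j) * \<gamma> j) + K * (1 + \<epsilon>) * \<gamma> n * (\<Sum>i=1..<L. k i))"
        by (simp add: sum_distrib_left)
      also have "\<dots> \<le> F * \<gamma> n + (C * (1 + \<epsilon>) * \<gamma> n * U
          + C * K * (\<epsilon> * \<gamma> n) + K * (1 + \<epsilon>) * \<gamma> n * S)"
      proof (intro add_mono mult_left_mono order_refl N)
        show "(\<Sum>j<L. u j) \<le> U" unfolding U_def by (intro sum_le_suminf us u) auto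
        have "(\<Sum>i=1..<L. k i) = (\<Sum>i<m0. k (Suc i))"
          by (simp only: L_def One_nat_def sum.shift_bounds_Suc_ivl atLeast0LessThan)
        also have "\<dots> \<le> S" unfolding S_def by (intro sum_le_suminf ks k) auto
        finally show "(\<Sum>i=1..<L. k i) \<le> S" .
      qed (use C F Kpos \<epsilon> pos[of n] False in auto)
      also have "\<dots> = (F + C * (1 + \<epsilon>) * U + K * (S + \<epsilon> * (C + S))) * \<gamma> n"
        by (simp add: algebra_simps)
      also have "\<dots> \<le> (K * ((1 - S) / 2) + K * (S + \<epsilon> * (C + 1))) * \<gamma> n"
        using K0 Kpos S \<epsilon>(1) pos[of n] by (intro mult_right_mono add_mono mult_left_mono) auto
      also have "\<dots> = K * \<gamma> n" by (simp add: \<epsilon>(2) field_simps)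
      finally show ?thesis .
    qed (use K in auto)
  qed
  with Kpos show ?thesis using that by blast
qed

text \<open>A limit T must satisfy T = \<phi> + \<kappa> (u(0) + u(1) + ...) + T S, with S the mass of the kernel: divide the equation
by \<gamma>(n) and let n tend to infinity in the two outer ranges of the convolution. For convergence,
consider the distance d(n) of u(n) / \<gamma>(n) from T. Old distances enter d(n) with total weight at most about S,
while all other contributions are eventually as small as desired. So an eventual bound D for d improves to (1 + S) / 2 times D,
and iteration forces d to zero.\<close>
lemma renewal_limit:
  fixes k f u \<gamma> :: "nat \<Rightarrow> real"
  assumes \<gamma>: "\<gamma> \<in> weight_class 1"
    and k: "\<And>j. k (Suc j) \<ge> 0" "(\<Sum>j. k (Suc j)) < 1" "(\<lambda>n. k n / \<gamma> n) \<longlonglongrightarrow> \<kappa>"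
    and f: "\<And>n. f n \<ge> 0" "(\<lambda>n. f n / \<gamma> n) \<longlonglongrightarrow> \<phi>"
    and u: "\<And>n. u n \<ge> 0" "\<And>n. u n = f n + (\<Sum>j<n. k (n - j) * u j)"
  shows "(\<lambda>n. u n / \<gamma> n) \<longlonglongrightarrow> (\<phi> + \<kappa> * suminf u) / (1 - (\<Sum>j. k (Suc j)))"
proof -
  note pos = weight_class_pos[OF \<gamma>] and sm = weight_class_summable[OF \<gamma>]
  define S where "S = (\<Sum>j. k (Suc j))"
  obtain C where C: "C > 0" "\<And>n. norm (k n / \<gamma> n) \<le> C"
    using convergent_imp_Bseq[OF convergentI[OF k(3)]] unfolding Bseq_def by blast
  obtain F where F: "F > 0" "\<And>n. norm (f n / \<gamma> n) \<le> F"
    using convergent_imp_Bseq[OF convergentI[OF f(2)]] unfolding Bseq_def by blast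
  have kC: "\<bar>k n\<bar> \<le> C * \<gamma> n" for n
    using C(2)[of n] pos[of n] by (simp add: pos_divide_le_eq)
  have fF: "f n \<le> F * \<gamma> n" for n
    using F(2)[of n] pos[of n] f(1)[of n] by (simp add: pos_divide_le_eq)
  obtain K where K: "K > 0" "\<And>n. u n \<le> K * \<gamma> n"
    using renewal_bounded[where k = k and f = f and u = u and C = C and F = F and thesis = thesis,
        OF \<gamma> k(1) abs_le_D1[OF kC] k(2) f(1) fF u] by metis
  have ks: "summable (\<lambda>j. k (Suc j))"
    by (rule summable_comparison_test[of _ "\<lambda>j. C * \<gamma> (Suc j)"])
       (use kC sm in \<open>auto intro!: summable_mult simp: summable_Suc_iff\<close>)
  have fs: "summable f"
    by (rule summable_comparison_test[of _ "\<lambda>j. F * \<gamma> j"])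
       (use fF f sm in \<open>auto intro!: summable_mult\<close>)
  have us: "summable u" by (rule renewal_summable(1)[where k = k and f = f and u = u, OF k(1) ks k(2) f(1) fs u])
  have S: "0 \<le> S" "S < 1" unfolding S_def using k suminf_nonneg[OF ks] by auto
  define T where "T = (\<phi> + \<kappa> * suminf u) / (1 - S)"
  have T: "\<phi> + \<kappa> * suminf u + T * S - T = 0" using S by (simp add: T_def field_simps)
  have pos_ne: "\<gamma> n \<noteq> 0" for n using pos[of n] by simp
  define d where "d n = \<bar>u n / \<gamma> n - T\<bar>" for n
  define \<theta> where "\<theta> = (1 + S) / 2"
  have \<theta>: "0 \<le> \<theta>" "\<theta> < 1" using S by (auto simp: \<theta>_def)
  have contract: "\<forall>\<^sub>F n in sequentially. d n \<le> \<theta> * D"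
    if D: "D > 0" and dD: "\<forall>\<^sub>F n in sequentially. d n \<le> D" for D
  proof -
    \<comment> \<open>Three errors of size \<open>\<delta>\<close> fit into the gap between \<open>S * D\<close> and \<open>\<theta> * D\<close>.\<close>
    define \<delta> where "\<delta> = (1 - S) / 8 * D"
    have \<delta>: "\<delta> > 0" using S D by (simp add: \<delta>_def)
    obtain m0 where m0: "\<And>m. m \<ge> m0 \<Longrightarrow> \<forall>\<^sub>F n in sequentially.
        (\<Sum>i=m..n-m. \<gamma> (n - i) * \<gamma> i) \<le> (\<delta> / (C * K)) * \<gamma> n"
      using weight_class_middle[OF \<gamma>, of "\<delta> / (C * K)"] \<delta> C K by auto
    have "(\<lambda>L. \<phi> + \<kappa> * (\<Sum>j<Suc L. u j) + T * (\<Sum>j<L. k (Suc j)) - T) \<longlonglongrightarrow>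
        \<phi> + \<kappa> * suminf u + T * S - T"
      unfolding S_def by (intro tendsto_intros summable_LIMSEQ LIMSEQ_Suc us ks)
    then have "(\<lambda>L. \<phi> + \<kappa> * (\<Sum>j<Suc L. u j) + T * (\<Sum>j<L. k (Suc j)) - T) \<longlonglongrightarrow> 0"
      by (simp only: T)
    from LIMSEQ_D[OF this \<delta>] obtain L0 where L0:
      "\<And>L. L \<ge> L0 \<Longrightarrow> \<bar>\<phi> + \<kappa> * (\<Sum>j<Suc L. u j) + T * (\<Sum>j<L. k (Suc j)) - T\<bar> < \<delta>"
      by auto
    define L where "L = Suc (max m0 L0)"
    have kL: "(\<Sum>i=1..<L. k i) = (\<Sum>i<max m0 L0. k (Suc i))"
      by (simp only: L_def One_nat_def sum.shift_bounds_Suc_ivl atLeast0LessThan)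
    \<comment> \<open>The deviation of the equation from its limit if all quotients \<open>u (n - i) / \<gamma> (n - i)\<close> in the last range
      were equal to \<open>T\<close>; \<open>Q\<close> below corrects for this, and \<open>R\<close> is the middle range.\<close>
    define E where "E n = f n / \<gamma> n + (\<Sum>j<L. k (n - j) / \<gamma> n * u j)
        + T * (\<Sum>i=1..<L. k i * (\<gamma> (n - i) / \<gamma> n)) - T" for n
    have kshift: "(\<lambda>n. k (n - j) / \<gamma> n) \<longlonglongrightarrow> \<kappa>" for j
    proof -
      have "(\<lambda>n. k (n - j) / \<gamma> (n - j)) \<longlonglongrightarrow> \<kappa>"
        by (rule LIMSEQ_offset[where k = j]) (simp add: k(3))
      from tendsto_mult[OF this weight_class_shift[OF \<gamma>, of j]]
      have "(\<lambda>n. k (n - j) / \<gamma> (n - j) * (\<gamma> (n - j) / \<gamma> n)) \<longlonglongrightarrow> \<kappa>" by simp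
      moreover have "k (n - j) / \<gamma> (n - j) * (\<gamma> (n - j) / \<gamma> n) = k (n - j) / \<gamma> n" for n
        using pos[of "n - j"] by simp
      ultimately show ?thesis by (simp only:)
    qed
    have "E \<longlonglongrightarrow> \<phi> + (\<Sum>j<L. \<kappa> * u j) + T * (\<Sum>i=1..<L. k i * 1) - T"
      unfolding E_def by (intro tendsto_intros f kshift weight_class_shift[OF \<gamma>])
    then have "(\<lambda>n. \<bar>E n\<bar>) \<longlonglongrightarrow> \<bar>\<phi> + \<kappa> * (\<Sum>j<L. u j) + T * (\<Sum>i=1..<L. k i) - T\<bar>"
      by (intro tendsto_rabs) (simp add: sum_distrib_left)
    then have ev1: "\<forall>\<^sub>F n in sequentially. \<bar>E n\<bar> < \<delta>"
      by (rule order_tendstoD) (unfold kL, use L0[of "max m0 L0"] in \<open>simp add: L_def\<close>)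
    have "(\<lambda>n. (\<Sum>i=1..<L. k i * (\<gamma> (n - i) / \<gamma> n)) * D) \<longlonglongrightarrow> (\<Sum>i=1..<L. k i * 1) * D"
      by (intro tendsto_intros weight_class_shift[OF \<gamma>])
    moreover have "(\<Sum>i=1..<L. k i * 1) * D < S * D + \<delta>"
    proof -
      have "(\<Sum>i=1..<L. k i) \<le> S"
        unfolding kL S_def by (intro sum_le_suminf ks k) auto
      then have "(\<Sum>i=1..<L. k i) * D \<le> S * D" using D by simp
      then show ?thesis using \<delta> by simp
    qed
    ultimately have ev2: "\<forall>\<^sub>F n in sequentially.
        (\<Sum>i=1..<L. k i * (\<gamma> (n - i) / \<gamma> n)) * D < S * D + \<delta>"
      by (rule order_tendstoD)
    from dD obtain N where N: "\<And>n. n \<ge> N \<Longrightarrow> d n \<le> D" by (auto simp: eventually_sequentially)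
    have Lpos: "0 < L" and "m0 \<le> L" by (auto simp: L_def)
    from m0[OF \<open>m0 \<le> L\<close>] ev1 ev2 eventually_ge_at_top[of "N + 2 * L"]
    show ?thesis
    proof eventually_elim
      case (elim n)
      have k0: "k i \<ge> 0" if "0 < i" for i
        using k(1)[of "i - 1"] that by auto
      define R where "R = (\<Sum>j=L..n-L. k (n - j) * u j) / \<gamma> n"
      define Q where "Q = (\<Sum>i=1..<L. k i * (\<gamma> (n - i) / \<gamma> n) * (u (n - i) / \<gamma> (n - i) - T))"
      have "u n = f n + ((\<Sum>j<L. k (n - j) * u j) + (\<Sum>j=L..n-L. k (n - j) * u j)
          + (\<Sum>i=1..<L. k (n - (n - i)) * u (n - i)))"
        using elim(4) Lpos by (subst u(2), subst convolution_split[of L]) auto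
      also have "(\<Sum>i=1..<L. k (n - (n - i)) * u (n - i)) = (\<Sum>i=1..<L. k i * u (n - i))"
        using elim by (intro sum.cong) auto
      finally have "u n / \<gamma> n = f n / \<gamma> n + (\<Sum>j<L. k (n - j) / \<gamma> n * u j) + R
          + (\<Sum>i=1..<L. k i * u (n - i) / \<gamma> n)"
        by (simp add: add_divide_distrib sum_divide_distrib R_def)
      moreover have "Q = (\<Sum>i=1..<L. k i * u (n - i) / \<gamma> n)
          - T * (\<Sum>i=1..<L. k i * (\<gamma> (n - i) / \<gamma> n))"
        unfolding Q_def sum_distrib_left sum_subtractf[symmetric]
        by (intro sum.cong refl) (use pos_ne in \<open>simp add: field_simps\<close>)
      ultimately have split: "u n / \<gamma> n - T = E n + R + Q" by (simp add: E_def)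
      have "0 \<le> R" unfolding R_def
        by (intro divide_nonneg_pos sum_nonneg mult_nonneg_nonneg k0 u pos)
           (use elim(4) Lpos in auto)
      have "(\<Sum>j=L..n-L. k (n - j) * u j) \<le> (\<Sum>j=L..n-L. (C * \<gamma> (n - j)) * (K * \<gamma> j))"
        by (intro sum_mono mult_mono K u order_trans[OF abs_ge_self kC] mult_nonneg_nonneg)
           (use C pos in \<open>auto simp: less_imp_le\<close>)
      also have "\<dots> = C * K * (\<Sum>j=L..n-L. \<gamma> (n - j) * \<gamma> j)"
        by (simp add: sum_distrib_left mult_ac)
      also have "\<dots> \<le> C * K * (\<delta> / (C * K) * \<gamma> n)"
        by (intro mult_left_mono elim) (use C K in auto)
      finally have "R \<le> \<delta>" using C K pos[of n] by (simp add: R_def pos_divide_le_eq)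
      have "\<bar>Q\<bar> \<le> (\<Sum>i=1..<L. k i * (\<gamma> (n - i) / \<gamma> n) * D)"
        unfolding Q_def
      proof (intro sum_abs[THEN order_trans] sum_mono)
        fix i assume i: "i \<in> {1..<L}"
        have "\<bar>k i * (\<gamma> (n - i) / \<gamma> n) * (u (n - i) / \<gamma> (n - i) - T)\<bar>
            = k i * (\<gamma> (n - i) / \<gamma> n) * d (n - i)"
          using k0[of i] i pos[of n] pos[of "n - i"] by (simp add: abs_mult d_def)
        also have "\<dots> \<le> k i * (\<gamma> (n - i) / \<gamma> n) * D"
          using k0[of i] i pos[of n] pos[of "n - i"] elim
          by (intro mult_left_mono N) auto
        finally show "\<bar>k i * (\<gamma> (n - i) / \<gamma> n) * (u (n - i) / \<gamma> (n - i) - T)\<bar>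
            \<le> k i * (\<gamma> (n - i) / \<gamma> n) * D" .
      qed
      also have "\<dots> < S * D + \<delta>" using elim by (simp add: sum_distrib_right)
      finally have "\<bar>Q\<bar> < S * D + \<delta>" .
      then have "d n \<le> S * D + 3 * \<delta>"
        using split elim \<open>0 \<le> R\<close> \<open>R \<le> \<delta>\<close> by (simp add: d_def)
      also have "\<dots> \<le> \<theta> * D"
        using S D by (simp add: \<delta>_def \<theta>_def field_simps)
      finally show ?case .
    qed
  qed
  define D0 where "D0 = K + \<bar>T\<bar>"
  have D0: "D0 > 0" using K by (simp add: D0_def)
  have iter: "\<forall>\<^sub>F n in sequentially. d n \<le> \<theta> ^ p * D0" for p
  proof (induction p)
    case 0
    have "d n \<le> D0" for n
    proof -
      have "u n / \<gamma> n \<le> K" "0 \<le> u n / \<gamma> n"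
        using K(2)[of n] u(1)[of n] pos[of n] by (auto simp: pos_divide_le_eq)
      then show ?thesis by (simp add: d_def D0_def)
    qed
    then show ?case by simp
  next
    case (Suc p)
    have "\<theta> > 0" using S by (simp add: \<theta>_def)
    then show ?case using contract[OF _ Suc] D0 by (simp add: mult_ac)
  qed
  have "(\<lambda>n. u n / \<gamma> n - T) \<longlonglongrightarrow> 0"
  proof (rule tendstoI)
    fix e :: real assume "e > 0"
    have "(\<lambda>p. \<theta> ^ p * D0) \<longlonglongrightarrow> 0 * D0"
      using \<theta> by (intro tendsto_intros LIMSEQ_power_zero) auto
    then have "\<forall>\<^sub>F p in sequentially. \<theta> ^ p * D0 < e"
      using \<open>e > 0\<close> by (intro order_tendstoD) auto
    then obtain p where p: "\<theta> ^ p * D0 < e" by (auto simp: eventually_sequentially)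
    show "\<forall>\<^sub>F n in sequentially. dist (u n / \<gamma> n - T) 0 < e"
      using iter[of p] by eventually_elim (use p in \<open>simp add: d_def\<close>)
  qed
  then have "(\<lambda>n. u n / \<gamma> n) \<longlonglongrightarrow> T" by (simp add: LIM_zero_iff)
  then show ?thesis by (simp add: T_def S_def)
qed

section \<open>The sequence z and its autocorrelations\<close>

declare arch_z.simps(2) [simp del]

lemma arch_z_pos_index:
  "0 < n \<Longrightarrow> arch_z l b n = l * (\<Sum>j<n. b (n - j) * arch_z l b j)"
  by (cases n) (auto simp: arch_z.simps(2))

lemma arch_z_renewal:
  "arch_z l b n = (if n = 0 then 1 else 0) + (\<Sum>j<n. (l * b (n - j)) * arch_z l b j)"
  by (cases "n = 0") (auto simp: arch_z_pos_index sum_distrib_left mult.assoc)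

lemma arch_z_nonneg:
  assumes "l \<ge> 0" "\<And>j. b (Suc j) \<ge> 0"
  shows "arch_z l b n \<ge> 0"
proof (induction n rule: less_induct)
  case (less n)
  have "b j \<ge> 0" if "0 < j" for j using assms(2)[of "j - 1"] that by simp
  with less assms(1) show ?case
    by (cases "n = 0") (auto simp: arch_z_pos_index intro!: sum_nonneg mult_nonneg_nonneg)
qed

lemma arch_z_ge:
  assumes "l \<ge> 0" "\<And>j. b (Suc j) \<ge> 0"
  shows "arch_z l b (Suc n) \<ge> l * b (Suc n)"
proof -
  have "b (Suc n - 0) * arch_z l b 0 \<le> (\<Sum>j<Suc n. b (Suc n - j) * arch_z l b j)"
  proof (rule member_le_sum)
    fix j assume "j \<in> {..<Suc n} - {0}"
    then have "Suc n - j = Suc (n - j)" by auto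
    then show "0 \<le> b (Suc n - j) * arch_z l b j" using assms arch_z_nonneg[of l b j] by simp
  qed auto
  from mult_left_mono[OF this assms(1)] show ?thesis by (simp add: arch_z.simps(2))
qed

lemma arch_z_summable:
  assumes "l \<ge> 0" "\<And>j. b (Suc j) \<ge> 0" "summable (\<lambda>j. b (Suc j))" "l * arch_coeff_sum b < 1"
  shows "summable (arch_z l b)" "suminf (arch_z l b) = 1 / (1 - l * arch_coeff_sum b)"
proof -
  define f :: "nat \<Rightarrow> real" where "f n = (if n = 0 then 1 else 0)" for n
  have f: "f sums 1" unfolding f_def using sums_single[of 0 "\<lambda>_. 1::real"] by simp
  have k: "summable (\<lambda>j. l * b (Suc j))" "(\<Sum>j. l * b (Suc j)) = l * arch_coeff_sum b"
    using assms(3) by (auto simp: arch_coeff_sum_def suminf_mult)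
  have "l * b (Suc j) \<ge> 0" "f j \<ge> 0" for j using assms by (auto simp: f_def)
  note R = renewal_summable[where k = "\<lambda>j. l * b j" and f = f and u = "arch_z l b",
      OF this(1) k(1) _ this(2) sums_summable[OF f] arch_z_nonneg[where b = b, OF assms(1,2)]
      arch_z_renewal[of l b, folded f_def], unfolded k(2), OF assms(4)]
  show "summable (arch_z l b)" by (rule R(1))
  show "suminf (arch_z l b) = 1 / (1 - l * arch_coeff_sum b)"
    using R(2) sums_unique[OF f] by simp
qed

text \<open>This is the renewal limit for a unit mass at 0 as source, which is negligible against \<beta>, with
1 / (1 - l B) as the sum of the solution. The sequence \<beta> is b with a positive value put in at index 0.\<close>
lemma arch_z_asymp:
  assumes \<beta>: "\<beta> \<in> weight_class 1" "\<And>n. n > 0 \<Longrightarrow> \<beta> n = b n"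
    and l: "l \<ge> 0" "l * arch_coeff_sum b < 1"
  shows "(\<lambda>n. arch_z l b n / \<beta> n) \<longlonglongrightarrow> l / (1 - l * arch_coeff_sum b)\<^sup>2"
proof -
  define f :: "nat \<Rightarrow> real" where "f n = (if n = 0 then 1 else 0)" for n
  have b0: "b (Suc j) \<ge> 0" for j
    using weight_class_pos[OF \<beta>(1), of "Suc j"] \<beta>(2)[of "Suc j"] by simp
  have bs: "summable (\<lambda>j. b (Suc j))"
    using weight_class_summable[OF \<beta>(1)] \<beta>(2) by (simp flip: summable_Suc_iff[of \<beta>])
  have k: "(\<Sum>j. l * b (Suc j)) = l * arch_coeff_sum b"
    using bs by (simp add: arch_coeff_sum_def suminf_mult)
  have k_lim: "(\<lambda>n. l * b n / \<beta> n) \<longlonglongrightarrow> l"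
  proof (rule tendsto_eventually)
    show "\<forall>\<^sub>F n in sequentially. l * b n / \<beta> n = l"
      using eventually_gt_at_top[of 0]
    proof eventually_elim
      case (elim n)
      then show ?case using \<beta>(2)[of n] weight_class_pos[OF \<beta>(1), of n] by simp
    qed
  qed
  have f_lim: "(\<lambda>n. f n / \<beta> n) \<longlonglongrightarrow> 0"
    by (rule tendsto_eventually) (use eventually_gt_at_top[of 0] in eventually_elim, simp add: f_def)
  have "l * b (Suc j) \<ge> 0" "f j \<ge> 0" for j using l b0 by (auto simp: f_def)
  note R = renewal_limit[where k = "\<lambda>j. l * b j" and f = f and u = "arch_z l b",
      OF \<beta>(1) this(1) _ k_lim this(2) f_lim arch_z_nonneg[where b = b, OF l(1) b0]
      arch_z_renewal[of l b, folded f_def], unfolded k, OF l(2)]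
  show ?thesis
    using R unfolding arch_z_summable(2)[where b = b, OF l(1) b0 bs l(2)] by (simp add: power2_eq_square)
qed

text \<open>Tonelli's theorem for series, in terms of \<open>sums\<close>.\<close>
lemma nonneg_double_sum_swap:
  fixes g :: "nat \<Rightarrow> nat \<Rightarrow> real"
  assumes g: "\<And>i j. g i j \<ge> 0" and row: "\<And>i. g i sums r i" and total: "r sums S"
    and col: "\<And>j. (\<lambda>i. g i j) sums c j"
  shows "c sums S"
proof -
  have r0: "r i \<ge> 0" for i using sums_le[OF g sums_zero row] .
  have row': "((\<lambda>j. case (i, j) of (i, j) \<Rightarrow> g i j) has_sum r i) UNIV" for i
    using sums_nonneg_imp_has_sum[OF row g] by simp
  have total': "(r has_sum S) UNIV" by (rule sums_nonneg_imp_has_sum[OF total r0])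
  have "(\<lambda>(i, j). g i j) summable_on UNIV \<times> UNIV"
    by (rule summable_on_SigmaI[OF row']) (use total' g in \<open>auto simp: summable_on_def\<close>)
  then have "((\<lambda>(i, j). g i j) has_sum S) (UNIV \<times> UNIV)"
    by (rule has_sum_SigmaI[OF row' total'])
  then have "((\<lambda>(j, i). g i j) has_sum S) (UNIV \<times> UNIV)"
    by (subst (asm) has_sum_swap) simp
  then have "(c has_sum S) UNIV"
    by (rule has_sum_SigmaD) (use sums_nonneg_imp_has_sum[OF col g] in simp)
  then show ?thesis by (rule has_sum_imp_sums)
qed

text \<open>For j \<ge> 1, replace the factor z(j) by l times the sum of b(i) z(j-i) over 1 \<le> i \<le> j, exchange the two
summations, and shift j by i.\<close>
lemma autocorrelation_recursion:
  fixes z :: "nat \<Rightarrow> real"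
  assumes l: "l \<ge> 0" and b: "\<And>j. b (Suc j) \<ge> 0" "summable (\<lambda>j. b (Suc j))"
    and z: "z = arch_z l b" "\<And>n. z n \<ge> 0" "summable z"
  defines "R \<equiv> \<lambda>k. \<Sum>j. z j * z (j + k)"
  shows "R k = z k + (\<Sum>i. l * b (Suc i) * R (k + Suc i))"
    and "0 \<le> R k" "R k \<le> (suminf z)\<^sup>2" "summable (\<lambda>j. z j * z (j + k))"
proof -
  have zS: "z n \<le> suminf z" for n
    using sum_le_suminf[OF z(3), of "{n}"] z(2) by simp
  have S0: "suminf z \<ge> 0" by (rule suminf_nonneg[OF z(3,2)])
  have sm: "summable (\<lambda>j. z j * z (j + k))" for k
  proof (rule summable_comparison_test)
    show "summable (\<lambda>j. z j * suminf z)" by (intro summable_mult2 z)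
    show "\<exists>N. \<forall>n\<ge>N. norm (z n * z (n + k)) \<le> z n * suminf z"
      using z(2) zS by (auto intro!: mult_left_mono)
  qed
  then show "summable (\<lambda>j. z j * z (j + k))" .
  show R0: "0 \<le> R k" for k unfolding R_def by (intro suminf_nonneg sm mult_nonneg_nonneg z)
  show R_le: "R k \<le> (suminf z)\<^sup>2" for k
  proof -
    have "R k \<le> (\<Sum>j. z j * suminf z)"
      unfolding R_def using z zS by (intro suminf_le sm summable_mult2 mult_left_mono) auto
    also have "\<dots> = (suminf z)\<^sup>2" using z(3) by (simp add: suminf_mult2[symmetric] power2_eq_square)
    finally show ?thesis .
  qed
  \<comment> \<open>Row \<open>i\<close> sums to the term of lag \<open>k + Suc i\<close>, column \<open>j > 0\<close> to \<open>z j * z (j + k)\<close>.\<close>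
  define g where "g i j = (if i < j then l * b (Suc i) * z (j - Suc i) * z (j + k) else 0)" for i j
  have g0: "g i j \<ge> 0" for i j using l b z by (simp add: g_def)
  have col: "(\<lambda>j. g i j) sums (l * b (Suc i) * R (k + Suc i))" for i
  proof -
    have "(\<lambda>j. g i (j + Suc i)) sums (l * b (Suc i) * R (k + Suc i))"
      using sums_mult[OF summable_sums[OF sm[of "k + Suc i"]], of "l * b (Suc i)"]
      by (simp add: g_def R_def add_ac mult_ac)
    moreover have "(\<Sum>j<Suc i. g i j) = 0" by (simp add: g_def)
    ultimately show ?thesis
      using sums_iff_shift[of "g i" "Suc i" "l * b (Suc i) * R (k + Suc i)"] by simp
  qed
  have total: "(\<lambda>i. l * b (Suc i) * R (k + Suc i)) sums (\<Sum>i. l * b (Suc i) * R (k + Suc i))"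
  proof (rule summable_sums, rule summable_comparison_test)
    show "summable (\<lambda>i. l * b (Suc i) * (suminf z)\<^sup>2)" by (intro summable_mult2 summable_mult b)
    show "\<exists>N. \<forall>n\<ge>N. norm (l * b (Suc n) * R (k + Suc n)) \<le> l * b (Suc n) * (suminf z)\<^sup>2"
      using l b R0 R_le by (auto simp: abs_mult intro!: mult_left_mono)
  qed
  have row: "(\<lambda>i. g i j) sums (if j = 0 then 0 else z j * z (j + k))" for j
  proof (cases j)
    case 0
    then show ?thesis by (simp add: g_def)
  next
    case (Suc n)
    have "(\<lambda>i. g i j) sums (\<Sum>i<j. g i j)"
      by (rule sums_finite) (auto simp: g_def)
    also have "(\<Sum>i<j. g i j) = l * (\<Sum>i<Suc n. b (Suc i) * z (Suc n - Suc i)) * z (j + k)"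
      unfolding sum_distrib_left sum_distrib_right
      by (rule sum.cong) (auto simp: g_def Suc)
    also have "(\<Sum>i<Suc n. b (Suc i) * z (Suc n - Suc i)) = (\<Sum>i<Suc n. b (Suc n - i) * z i)"
      by (subst sum.nat_diff_reindex[symmetric]) (auto intro!: sum.cong simp: Suc_diff_le)
    also have "l * \<dots> = z (Suc n)" by (simp only: z(1) arch_z.simps(2))
    finally show ?thesis by (simp add: Suc)
  qed
  have "(\<lambda>j. if j = 0 then 0 else z j * z (j + k)) sums (\<Sum>i. l * b (Suc i) * R (k + Suc i))"
    by (rule nonneg_double_sum_swap[OF g0 col total row])
  then have "(\<lambda>j. z (Suc j) * z (Suc j + k)) sums (\<Sum>i. l * b (Suc i) * R (k + Suc i))"
    by (subst (asm) sums_Suc_iff[symmetric, of "\<lambda>j. if j = 0 then 0 else z j * z (j + k)", simplified]) simp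
  then have "(\<Sum>j. z (Suc j) * z (Suc j + k)) = (\<Sum>i. l * b (Suc i) * R (k + Suc i))"
    by (rule sums_unique[symmetric])
  moreover have "R k = z 0 * z k + (\<Sum>j. z (Suc j) * z (Suc j + k))"
    using suminf_split_head[OF sm[of k]] by (simp add: R_def)
  ultimately show "R k = z k + (\<Sum>i. l * b (Suc i) * R (k + Suc i))"
    by (simp add: z(1))
qed

text \<open>Dominated convergence. For fixed j the quotient z(j+n) / \<beta>(n) tends to Z, since shifts do not change
\<beta> asymptotically, and it is bounded uniformly in j and n because \<beta> is non-increasing up to a factor.\<close>
lemma autocorrelation_asymp:
  fixes \<beta> z :: "nat \<Rightarrow> real"
  assumes \<beta>: "\<beta> \<in> weight_class_down 1"
    and z: "\<And>n. z n \<ge> 0" "summable z" "(\<lambda>n. z n / \<beta> n) \<longlonglongrightarrow> Z"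
  shows "(\<lambda>n. (\<Sum>j. z j * z (j + n)) / \<beta> n) \<longlonglongrightarrow> suminf z * Z"
proof -
  have \<beta>1: "\<beta> \<in> weight_class 1" using \<beta> by (simp add: weight_class_down_def)
  note pos = weight_class_pos[OF \<beta>1]
  have ne: "\<beta> n \<noteq> 0" for n using pos[of n] by simp
  obtain C where C: "C > 0" "\<And>i n. n \<le> i \<Longrightarrow> \<beta> i \<le> C * \<beta> n"
    using weight_class_down_quasi_decreasing[OF \<beta>] by metis
  obtain K where K: "K > 0" "\<And>n. norm (z n / \<beta> n) \<le> K"
    using convergent_imp_Bseq[OF convergentI[OF z(3)]] unfolding Bseq_def by blast
  have zK: "z n \<le> K * \<beta> n" for n
    using K(2)[of n] pos[of n] z(1)[of n] by (simp add: pos_divide_le_eq)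
  have bound: "z (j + n) \<le> K * C * \<beta> n" for j n
  proof -
    have "z (j + n) \<le> K * \<beta> (j + n)" by (rule zK)
    also have "\<dots> \<le> K * (C * \<beta> n)" using K by (intro mult_left_mono C) auto
    finally show ?thesis by (simp add: mult.assoc)
  qed
  have lim: "(\<lambda>n. z j * z (j + n) / \<beta> n) \<longlonglongrightarrow> z j * Z" for j
  proof -
    have "(\<lambda>n. \<beta> (n + j - j) / \<beta> (n + j)) \<longlonglongrightarrow> 1"
      by (rule LIMSEQ_ignore_initial_segment[OF weight_class_shift[OF \<beta>1]])
    then have "(\<lambda>n. inverse (\<beta> n / \<beta> (n + j))) \<longlonglongrightarrow> inverse 1"
      by (intro tendsto_inverse) auto
    from tendsto_mult[OF tendsto_const tendsto_mult[OF LIMSEQ_ignore_initial_segment[OF z(3), of j] this]]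
    have "(\<lambda>n. z j * (z (n + j) / \<beta> (n + j) * inverse (\<beta> n / \<beta> (n + j)))) \<longlonglongrightarrow> z j * (Z * inverse 1)" .
    moreover have "z j * (z (n + j) / \<beta> (n + j) * inverse (\<beta> n / \<beta> (n + j))) = z j * z (j + n) / \<beta> n" for n
      using ne[of "n + j"] by (simp add: add.commute)
    ultimately show ?thesis by (simp only: inverse_1 mult_1_right)
  qed
  have dom: "\<forall>\<^sub>F (j, n) in at_top \<times>\<^sub>F sequentially. norm (z j * z (j + n) / \<beta> n) \<le> z j * (K * C)"
  proof (intro always_eventually allI, clarify)
    fix j n
    have "z (j + n) / \<beta> n \<le> K * C"
      using bound[of j n] pos[of n] by (simp add: pos_divide_le_eq)
    from mult_left_mono[OF this z(1)[of j]]
    show "norm (z j * z (j + n) / \<beta> n) \<le> z j * (K * C)"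
      using z(1)[of j] z(1)[of "j + n"] pos[of n] by simp
  qed
  have "(\<lambda>n. \<Sum>j. z j * z (j + n) / \<beta> n) \<longlonglongrightarrow> (\<Sum>j. z j * Z)"
    using tannerys_theorem[OF lim dom summable_mult2[OF z(2)]] by simp
  moreover have "(\<Sum>j. z j * Z) = suminf z * Z" by (rule suminf_mult2[OF z(2), symmetric])
  moreover have "(\<Sum>j. z j * z (j + n) / \<beta> n) = (\<Sum>j. z j * z (j + n)) / \<beta> n" for n
  proof (rule suminf_divide)
    show "summable (\<lambda>j. z j * z (j + n))"
      by (rule summable_comparison_test[OF _ summable_mult2[OF z(2), of "K * C * \<beta> n"]])
         (use z(1) bound in \<open>auto intro!: mult_left_mono\<close>)
  qed
  ultimately show ?thesis by simp
qed

text \<open>The square of the sum of z is the sum of z(i) z(j) over all pairs. Sort the pairs by their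
difference k = i - j; the pairs with a given k are indexed by the minimum of i and j.\<close>
lemma autocorrelation_has_sum:
  fixes z :: "nat \<Rightarrow> real"
  assumes z: "\<And>n. z n \<ge> 0" "summable z"
  shows "((\<lambda>k::int. \<Sum>j. z j * z (j + nat \<bar>k\<bar>)) has_sum (suminf z)\<^sup>2) UNIV"
proof -
  have zsum: "(z has_sum suminf z) UNIV"
    by (rule sums_nonneg_imp_has_sum[OF summable_sums[OF z(2)] z(1)])
  have inner: "((\<lambda>j. case (i, j) of (i, j) \<Rightarrow> z i * z j) has_sum z i * suminf z) UNIV" for i
    using has_sum_cmult_right[OF zsum, of "z i"] by simp
  have outer: "((\<lambda>i. z i * suminf z) has_sum (suminf z)\<^sup>2) UNIV"
    using has_sum_cmult_left[OF zsum, of "suminf z"] by (simp add: power2_eq_square)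
  have "(\<lambda>(i, j). z i * z j) summable_on UNIV \<times> UNIV"
    by (rule summable_on_SigmaI[OF inner]) (use outer z in \<open>auto simp: summable_on_def\<close>)
  then have "((\<lambda>(i, j). z i * z j) has_sum (suminf z)\<^sup>2) (UNIV \<times> UNIV)"
    by (rule has_sum_SigmaI[OF inner outer])
  moreover
  define g :: "int \<times> nat \<Rightarrow> nat \<times> nat" where "g = (\<lambda>(k, l). (l + nat k, l + nat (- k)))"
  have "bij_betw g (UNIV \<times> UNIV) (UNIV \<times> UNIV)"
    by (rule bij_betwI[of _ _ _ "\<lambda>(i, j). (int i - int j, min i j)"]) (auto simp: g_def)
  ultimately have "((\<lambda>x. (\<lambda>(i, j). z i * z j) (g x)) has_sum (suminf z)\<^sup>2) (UNIV \<times> UNIV)"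
    by (simp only: has_sum_reindex_bij_betw)
  moreover have "(\<lambda>x. (\<lambda>(i, j). z i * z j) (g x)) = (\<lambda>(k, l). z l * z (l + nat \<bar>k\<bar>))"
  proof (rule ext, clarify)
    fix k :: int and l :: nat
    show "(\<lambda>(i, j). z i * z j) (g (k, l)) = z l * z (l + nat \<bar>k\<bar>)"
      by (cases "k \<ge> 0") (auto simp: g_def)
  qed
  ultimately have "((\<lambda>(k, l). z l * z (l + nat \<bar>k\<bar>)) has_sum (suminf z)\<^sup>2) (UNIV \<times> UNIV)"
    by (simp only:)
  moreover have "((\<lambda>l. case (k, l) of (k, l) \<Rightarrow> z l * z (l + nat \<bar>k\<bar>)) has_sum
      (\<Sum>l. z l * z (l + nat \<bar>k\<bar>))) UNIV" for k :: int
  proof -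
    have zS: "z n \<le> suminf z" for n
      using sum_le_suminf[OF z(2), of "{n}"] z(1) by simp
    have "summable (\<lambda>l. z l * z (l + nat \<bar>k\<bar>))"
      by (rule summable_comparison_test[OF _ summable_mult2[OF z(2), of "suminf z"]])
         (use z(1) zS in \<open>auto intro!: mult_left_mono\<close>)
    from sums_nonneg_imp_has_sum[OF summable_sums[OF this]] show ?thesis using z(1) by simp
  qed
  ultimately show ?thesis by (rule has_sum_SigmaD)
qed

text \<open>The recursion shows that a bound for d may be multiplied by the sum of c, any number of times.\<close>
lemma bounded_forward_recursion_zero:
  fixes d c :: "nat \<Rightarrow> real"
  assumes c: "\<And>j. c j \<ge> 0" "summable c" "suminf c < 1"
    and d: "\<And>k. \<bar>d k\<bar> \<le> K" "\<And>k. d k = (\<Sum>j. c j * d (k + Suc j))"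
  shows "d k = 0"
proof -
  have step: "\<bar>d k\<bar> \<le> suminf c * D" if D: "\<And>k. \<bar>d k\<bar> \<le> D" for D k
  proof -
    have le: "\<bar>c j * d (k + Suc j)\<bar> \<le> D * c j" for j
      using mult_left_mono[OF D c(1)] by (simp add: abs_mult c(1) mult.commute)
    have sm: "summable (\<lambda>j. D * c j)" by (intro summable_mult c)
    have sm': "summable (\<lambda>j. \<bar>c j * d (k + Suc j)\<bar>)"
      by (rule summable_comparison_test[OF _ sm]) (use le in auto)
    have "\<bar>d k\<bar> \<le> (\<Sum>j. \<bar>c j * d (k + Suc j)\<bar>)"
      using summable_rabs[OF sm'] by (simp only: d(2)[of k, symmetric])
    also have "\<dots> \<le> (\<Sum>j. D * c j)" by (rule suminf_le[OF le sm' sm])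
    finally show ?thesis using c(2) by (simp add: suminf_mult mult.commute)
  qed
  have "\<bar>d k\<bar> \<le> suminf c ^ p * K" for p k
  proof (induction p arbitrary: k)
    case 0
    show ?case using d(1)[of k] by simp
  next
    case (Suc p)
    from step[OF this, of k] show ?case by (simp add: mult.assoc)
  qed
  moreover have "(\<lambda>p. suminf c ^ p * K) \<longlonglongrightarrow> 0 * K"
    using c suminf_nonneg[OF c(2,1)] by (intro tendsto_intros LIMSEQ_power_zero) auto
  ultimately have "\<bar>d k\<bar> \<le> 0 * K" by (intro LIMSEQ_le_const) auto
  then show ?thesis by simp
qed

section \<open>Square-integrable random variables\<close>

definition square_integrable :: "'a measure \<Rightarrow> ('a \<Rightarrow> real) \<Rightarrow> bool" where
  "square_integrable M f \<longleftrightarrow> f \<in> borel_measurable M \<and> integrable M (\<lambda>x. (f x)\<^sup>2)"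

definition L2norm :: "'a measure \<Rightarrow> ('a \<Rightarrow> real) \<Rightarrow> real" where
  "L2norm M f = sqrt (\<integral>x. (f x)\<^sup>2 \<partial>M)"

lemma square_integrableD:
  assumes "square_integrable M f"
  shows "f \<in> borel_measurable M" "integrable M (\<lambda>x. (f x)\<^sup>2)"
  using assms by (auto simp: square_integrable_def)

lemma square_integrable_mult:
  assumes f: "square_integrable M f" and g: "square_integrable M g"
  shows "integrable M (\<lambda>x. f x * g x)"
proof (rule Bochner_Integration.integrable_bound)
  note [measurable] = square_integrableD(1)[OF f] square_integrableD(1)[OF g]
  show "integrable M (\<lambda>x. (f x)\<^sup>2 + (g x)\<^sup>2)"
    using f g by (auto simp: square_integrable_def)
  show "(\<lambda>x. f x * g x) \<in> borel_measurable M" by measurable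
  show "AE x in M. norm (f x * g x) \<le> norm ((f x)\<^sup>2 + (g x)\<^sup>2)"
  proof (rule AE_I2)
    fix x
    have "2 * (\<bar>f x\<bar> * \<bar>g x\<bar>) \<le> (f x)\<^sup>2 + (g x)\<^sup>2"
      using zero_le_power2[of "\<bar>f x\<bar> - \<bar>g x\<bar>"] by (simp add: power2_diff)
    moreover have "0 \<le> \<bar>f x\<bar> * \<bar>g x\<bar>" by simp
    ultimately have "\<bar>f x\<bar> * \<bar>g x\<bar> \<le> (f x)\<^sup>2 + (g x)\<^sup>2" by linarith
    then show "norm (f x * g x) \<le> norm ((f x)\<^sup>2 + (g x)\<^sup>2)"
      by (simp add: abs_mult)
  qed
qed

lemma square_integrable_cmult:
  "square_integrable M f \<Longrightarrow> square_integrable M (\<lambda>x. c * f x)"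
  by (auto simp: square_integrable_def power_mult_distrib)

lemma square_integrable_add:
  assumes f: "square_integrable M f" and g: "square_integrable M g"
  shows "square_integrable M (\<lambda>x. f x + g x)"
proof -
  note [measurable] = square_integrableD(1)[OF f] square_integrableD(1)[OF g]
  have "integrable M (\<lambda>x. (f x)\<^sup>2 + (g x)\<^sup>2 + 2 * (f x * g x))"
    using f g square_integrable_mult[OF f g] by (auto simp: square_integrable_def)
  then show ?thesis
    by (simp add: square_integrable_def power2_sum mult.assoc)
qed

lemma square_integrable_diff:
  assumes f: "square_integrable M f" and g: "square_integrable M g"
  shows "square_integrable M (\<lambda>x. f x - g x)"
  using square_integrable_add[OF f square_integrable_cmult[OF g, of "-1"]] by simp

lemma square_integrable_const: "finite_measure M \<Longrightarrow> square_integrable M (\<lambda>x. c)"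
  by (simp add: square_integrable_def finite_measure.integrable_const)

lemma square_integrable_sum:
  assumes "finite_measure M" "\<And>i. i \<in> A \<Longrightarrow> square_integrable M (f i)"
  shows "square_integrable M (\<lambda>x. \<Sum>i\<in>A. f i x)"
  using assms(2)
proof (induction A rule: infinite_finite_induct)
  case (insert i A)
  then show ?case by (simp add: square_integrable_add)
qed (simp_all add: square_integrable_const[OF assms(1)])

lemma L2norm_nonneg: "L2norm M f \<ge> 0"
  by (simp add: L2norm_def)

text \<open>Integrating (s \<bar>f\<bar> - t \<bar>g\<bar>)^2 \<ge> 0 bounds 2 s t times the integral of \<bar>f g\<bar>; the choice s^2 = B, t^2 = A is optimal. If A
or B vanishes, letting the parameter in front of it grow shows that the integral vanishes as well.\<close>
lemma Cauchy_Schwarz_L2: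
  assumes f: "square_integrable M f" and g: "square_integrable M g"
  shows "(\<integral>x. \<bar>f x * g x\<bar> \<partial>M) \<le> L2norm M f * L2norm M g"
proof -
  let ?F = "\<lambda>x. \<bar>f x\<bar>" and ?G = "\<lambda>x. \<bar>g x\<bar>"
  define A where "A = (\<integral>x. (f x)\<^sup>2 \<partial>M)"
  define B where "B = (\<integral>x. (g x)\<^sup>2 \<partial>M)"
  define I where "I = (\<integral>x. \<bar>f x * g x\<bar> \<partial>M)"
  have int: "integrable M (\<lambda>x. \<bar>f x * g x\<bar>)"
    using square_integrable_mult[OF f g] by simp
  note ints = int square_integrableD(2)[OF f] square_integrableD(2)[OF g]
  have A: "A \<ge> 0" and B: "B \<ge> 0" and I: "I \<ge> 0" by (simp_all add: A_def B_def I_def)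
  have quad: "2 * I * (s * t) \<le> s\<^sup>2 * A + t\<^sup>2 * B" if "s \<ge> 0" "t \<ge> 0" for s t
  proof -
    have "0 \<le> (\<integral>x. s\<^sup>2 * (f x)\<^sup>2 + t\<^sup>2 * (g x)\<^sup>2 - 2 * (s * t) * \<bar>f x * g x\<bar> \<partial>M)"
    proof (rule integral_nonneg_AE, rule AE_I2)
      fix x
      have "0 \<le> (s * \<bar>f x\<bar> - t * \<bar>g x\<bar>)\<^sup>2" by simp
      also have "\<dots> = s\<^sup>2 * (f x)\<^sup>2 + t\<^sup>2 * (g x)\<^sup>2 - 2 * (s * t) * \<bar>f x * g x\<bar>"
        by (simp add: power2_diff power_mult_distrib abs_mult)
      finally show "0 \<le> \<dots>" .
    qed
    also have "\<dots> = s\<^sup>2 * A + t\<^sup>2 * B - 2 * (s * t) * I"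
      using ints by (simp add: A_def B_def I_def)
    finally show ?thesis by (simp add: algebra_simps)
  qed
  have "I \<le> sqrt A * sqrt B"
  proof (cases "A = 0 \<or> B = 0")
    case True
    have "I \<le> 0"
    proof (rule ccontr)
      assume "\<not> I \<le> 0"
      then have "I > 0" by simp
      show False
      proof (cases "A = 0")
        case True
        have "2 * I * ((B + 1) / I * 1) \<le> ((B + 1) / I)\<^sup>2 * A + 1\<^sup>2 * B"
          by (rule quad) (use B \<open>I > 0\<close> in auto)
        then show False using True B \<open>I > 0\<close> by simp
      next
        case False
        with \<open>A = 0 \<or> B = 0\<close> have "B = 0" by simp
        have "2 * I * (1 * ((A + 1) / I)) \<le> 1\<^sup>2 * A + ((A + 1) / I)\<^sup>2 * B"
          by (rule quad) (use A \<open>I > 0\<close> in auto)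
        then show False using \<open>B = 0\<close> A \<open>I > 0\<close> by simp
      qed
    qed
    then show ?thesis using A B by (meson mult_nonneg_nonneg order_trans real_sqrt_ge_zero)
  next
    case False
    then have "A > 0" "B > 0" using A B by auto
    have "2 * I * (sqrt B * sqrt A) \<le> (sqrt B)\<^sup>2 * A + (sqrt A)\<^sup>2 * B"
      by (rule quad) (use A B in auto)
    also have "\<dots> = 2 * (sqrt A * sqrt B) * (sqrt B * sqrt A)"
      using A B by (simp add: mult_ac flip: power2_eq_square)
    finally show ?thesis using \<open>A > 0\<close> \<open>B > 0\<close> by (simp add: mult.commute)
  qed
  then show ?thesis by (simp add: L2norm_def A_def B_def I_def)
qed

text \<open>By Tonelli's theorem the series of absolute values has finite expectation, so it converges almost surely,
and sums and integrals may be exchanged.\<close>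
lemma weighted_series_integral:
  fixes f :: "nat \<Rightarrow> 'a \<Rightarrow> real"
  assumes c: "\<And>j. c j \<ge> 0" "summable c"
    and f: "\<And>j. integrable M (f j)" "\<And>j. (\<integral>x. \<bar>f j x\<bar> \<partial>M) \<le> K"
  shows weighted_series_AE: "AE x in M. summable (\<lambda>j. \<bar>c j * f j x\<bar>)"
    and weighted_series_integrable: "integrable M (\<lambda>x. \<Sum>j. c j * f j x)"
    and weighted_series_sums: "(\<lambda>j. c j * (\<integral>x. f j x \<partial>M)) sums (\<integral>x. (\<Sum>j. c j * f j x) \<partial>M)"
    and weighted_series_bound: "(\<integral>x. \<bar>\<Sum>j. c j * f j x\<bar> \<partial>M) \<le> K * suminf c"
proof -
  note [measurable] = borel_measurable_integrable[OF f(1)]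
  have int: "integrable M (\<lambda>x. c j * f j x)" for j using f by simp
  have int_abs: "(\<integral>x. \<bar>c j * f j x\<bar> \<partial>M) = c j * (\<integral>x. \<bar>f j x\<bar> \<partial>M)" for j
    using c by (simp add: abs_mult)
  have le: "(\<integral>x. \<bar>c j * f j x\<bar> \<partial>M) \<le> K * c j" for j
    unfolding int_abs using mult_left_mono[OF f(2) c(1)] by (simp add: mult.commute)
  have sm: "summable (\<lambda>j. \<integral>x. \<bar>c j * f j x\<bar> \<partial>M)"
    by (rule summable_comparison_test[of _ "\<lambda>j. K * c j"]) (use le c in \<open>auto intro!: summable_mult\<close>)
  have int': "integrable M (\<lambda>x. \<bar>c j * f j x\<bar>)" for j by (rule integrable_abs[OF int])
  have nn_eq: "(\<integral>\<^sup>+x. ennreal \<bar>c j * f j x\<bar> \<partial>M) = ennreal (\<integral>x. \<bar>c j * f j x\<bar> \<partial>M)" for j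
    by (rule nn_integral_eq_integral[OF int']) simp
  have "(\<integral>\<^sup>+x. (\<Sum>j. ennreal \<bar>c j * f j x\<bar>) \<partial>M) = (\<Sum>j. \<integral>\<^sup>+x. ennreal \<bar>c j * f j x\<bar> \<partial>M)"
    by (intro nn_integral_suminf) measurable
  also have "\<dots> = (\<Sum>j. ennreal (\<integral>x. \<bar>c j * f j x\<bar> \<partial>M))"
    by (simp only: nn_eq)
  also have "\<dots> \<noteq> \<infinity>"
    unfolding infinity_ennreal_def by (rule ennreal_suminf_neq_top[OF sm]) simp
  finally have "AE x in M. (\<Sum>j. ennreal \<bar>c j * f j x\<bar>) \<noteq> \<infinity>"
    by (rule nn_integral_noteq_infinite[rotated]) measurable
  then show AE: "AE x in M. summable (\<lambda>j. \<bar>c j * f j x\<bar>)"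
    by eventually_elim (rule summable_suminf_not_top, simp_all)
  have AE': "AE x in M. summable (\<lambda>j. norm (c j * f j x))"
    using AE by simp
  have sm': "summable (\<lambda>j. \<integral>x. norm (c j * f j x) \<partial>M)"
    using sm by simp
  show "integrable M (\<lambda>x. \<Sum>j. c j * f j x)"
    by (rule integrable_suminf[OF int AE' sm'])
  then have abs_int: "integrable M (\<lambda>x. \<bar>\<Sum>j. c j * f j x\<bar>)" by simp
  show "(\<lambda>j. c j * (\<integral>x. f j x \<partial>M)) sums (\<integral>x. (\<Sum>j. c j * f j x) \<partial>M)"
    using sums_integral[OF int AE' sm'] by simp
  have AE'': "AE x in M. summable (\<lambda>j. norm \<bar>c j * f j x\<bar>)"
    using AE by simp
  have sm'': "summable (\<lambda>j. \<integral>x. norm \<bar>c j * f j x\<bar> \<partial>M)"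
    using sm by simp
  have "(\<integral>x. \<bar>\<Sum>j. c j * f j x\<bar> \<partial>M) \<le> (\<integral>x. (\<Sum>j. \<bar>c j * f j x\<bar>) \<partial>M)"
    using AE by (intro integral_mono_AE abs_int integrable_suminf[OF int' AE'' sm''])
      (auto elim!: eventually_mono intro: summable_rabs)
  also have "\<dots> = (\<Sum>j. \<integral>x. \<bar>c j * f j x\<bar> \<partial>M)"
    by (rule integral_suminf[OF int' AE'' sm''])
  also have "\<dots> \<le> (\<Sum>j. K * c j)"
    by (intro suminf_le le sm summable_mult c)
  also have "\<dots> = K * suminf c" using c by (simp add: suminf_mult)
  finally show "(\<integral>x. \<bar>\<Sum>j. c j * f j x\<bar> \<partial>M) \<le> K * suminf c" .
qed

text \<open>Pointwise, by the Cauchy-Schwarz inequality for sums, the square of the series is at most the total weight times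
the weighted series of the squares, whose integral is finite.\<close>
lemma weighted_series_square_integrable:
  fixes f :: "nat \<Rightarrow> 'a \<Rightarrow> real"
  assumes c: "\<And>j. c j \<ge> 0" "summable c"
    and f: "\<And>j. square_integrable M (f j)" "\<And>j. (\<integral>x. (f j x)\<^sup>2 \<partial>M) \<le> K"
    and AE: "AE x in M. summable (\<lambda>j. c j * f j x)"
  shows "square_integrable M (\<lambda>x. \<Sum>j. c j * f j x)"
proof -
  note [measurable] = square_integrableD(1)[OF f(1)]
  have f2: "integrable M (\<lambda>x. (f j x)\<^sup>2)" "(\<integral>x. \<bar>(f j x)\<^sup>2\<bar> \<partial>M) \<le> K" for j
    using f square_integrableD(2)[OF f(1)] by auto
  have ptw: "(\<Sum>j. c j * f j x)\<^sup>2 \<le> suminf c * (\<Sum>j. c j * (f j x)\<^sup>2)"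
    if s1: "summable (\<lambda>j. c j * f j x)" and s2: "summable (\<lambda>j. \<bar>c j * (f j x)\<^sup>2\<bar>)" for x
  proof -
    have s2': "summable (\<lambda>j. c j * (f j x)\<^sup>2)" using s2 by (rule summable_rabs_cancel)
    have "(\<Sum>j<n. c j * f j x)\<^sup>2 \<le> suminf c * (\<Sum>j. c j * (f j x)\<^sup>2)" for n
    proof -
      have "(\<Sum>j<n. c j * f j x)\<^sup>2 = (\<Sum>j<n. sqrt (c j) * (sqrt (c j) * f j x))\<^sup>2"
        using c(1) by (simp add: mult.assoc[symmetric])
      also have "\<dots> \<le> (\<Sum>j<n. (sqrt (c j))\<^sup>2) * (\<Sum>j<n. (sqrt (c j) * f j x)\<^sup>2)"
        by (rule Cauchy_Schwarz_ineq_sum)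
      also have "\<dots> = (\<Sum>j<n. c j) * (\<Sum>j<n. c j * (f j x)\<^sup>2)"
        using c(1) by (simp add: power_mult_distrib)
      also have "\<dots> \<le> suminf c * (\<Sum>j. c j * (f j x)\<^sup>2)"
        using c s2' by (intro mult_mono sum_le_suminf sum_nonneg suminf_nonneg) auto
      finally show ?thesis .
    qed
    then show ?thesis
      by (intro LIMSEQ_le_const2[OF tendsto_power[OF summable_LIMSEQ[OF s1]]]) auto
  qed
  have AE2: "AE x in M. summable (\<lambda>j. \<bar>c j * (f j x)\<^sup>2\<bar>)"
    by (rule weighted_series_AE[OF c f2])
  have meas: "(\<lambda>x. \<Sum>j. c j * f j x) \<in> borel_measurable M" by measurable
  have int: "integrable M (\<lambda>x. suminf c * (\<Sum>j. c j * (f j x)\<^sup>2))"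
    by (intro integrable_mult_right weighted_series_integrable[OF c f2])
  have "AE x in M. norm ((\<Sum>j. c j * f j x)\<^sup>2) \<le> norm (suminf c * (\<Sum>j. c j * (f j x)\<^sup>2))"
    using AE AE2
  proof eventually_elim
    case (elim x)
    have "0 \<le> (\<Sum>j. c j * f j x)\<^sup>2" by simp
    with ptw[OF elim] show ?case by simp
  qed
  from Bochner_Integration.integrable_bound[OF int borel_measurable_power[OF meas] this] meas
  show ?thesis by (simp add: square_integrable_def)
qed

section \<open>Independent and identically distributed noise\<close>

locale iid_noise = prob_space M for M :: "'a measure" +
  fixes \<xi> :: "int \<Rightarrow> 'a \<Rightarrow> real"
  assumes indep: "indep_vars (\<lambda>_. borel) \<xi> UNIV"
    and ident: "\<And>k. distr M borel (\<xi> k) = distr M borel (\<xi> 0)"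
    and noise_sq_int: "integrable M (\<lambda>\<omega>. (\<xi> 0 \<omega>)\<^sup>2)"
begin

text \<open>The information in the noise variables with index in A. Measurability with respect to it replaces an explicit
representation as a function of these variables, since it passes automatically to sums, products and limits.\<close>
definition noise_algebra :: "int set \<Rightarrow> 'a measure" where
  "noise_algebra A = vimage_algebra (space M) (\<lambda>\<omega>. \<lambda>i\<in>A. \<xi> i \<omega>) (PiM A (\<lambda>_. borel))"

abbreviation noise_mean :: real where "noise_mean \<equiv> expectation (\<xi> 0)"

abbreviation noise_var :: real where "noise_var \<equiv> expectation (\<lambda>\<omega>. (\<xi> 0 \<omega>)\<^sup>2) - noise_mean\<^sup>2"

lemma noise_measurable [measurable]: "\<xi> k \<in> borel_measurable M"
  using indep by (simp add: indep_vars_def)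

lemma space_noise_algebra: "space (noise_algebra A) = space M"
  by (simp add: noise_algebra_def)

lemma noise_measurable_algebra:
  assumes "i \<in> A" shows "\<xi> i \<in> borel_measurable (noise_algebra A)"
proof -
  have "(\<lambda>\<omega>. \<lambda>i\<in>A. \<xi> i \<omega>) \<in> measurable (noise_algebra A) (PiM A (\<lambda>_. borel))"
    unfolding noise_algebra_def by (rule measurable_vimage_algebra1) (auto simp: space_PiM)
  from measurable_compose[OF this measurable_component_singleton[OF assms]]
  have "(\<lambda>\<omega>. (\<lambda>i\<in>A. \<xi> i \<omega>) i) \<in> borel_measurable (noise_algebra A)" .
  then show ?thesis using assms by simp
qed

lemma noise_algebra_le:
  assumes "space N = space M" "\<And>i. i \<in> A \<Longrightarrow> \<xi> i \<in> borel_measurable N"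
    and "H \<in> borel_measurable (noise_algebra A)"
  shows "H \<in> borel_measurable N"
proof -
  have "sets (noise_algebra A) \<subseteq> sets N"
    unfolding noise_algebra_def using assms
    by (intro sets_image_in_sets measurable_restrict) auto
  then have "subalgebra N (noise_algebra A)"
    using assms(1) by (simp add: subalgebra_def space_noise_algebra)
  from measurable_from_subalg[OF this assms(3)] show ?thesis .
qed

lemma noise_algebra_measurable:
  "H \<in> borel_measurable (noise_algebra A) \<Longrightarrow> H \<in> borel_measurable M"
  by (rule noise_algebra_le) auto

lemma noise_algebra_mono:
  "A \<subseteq> B \<Longrightarrow> H \<in> borel_measurable (noise_algebra A) \<Longrightarrow> H \<in> borel_measurable (noise_algebra B)"
  by (rule noise_algebra_le) (auto simp: space_noise_algebra intro: noise_measurable_algebra)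

text \<open>Disjoint blocks of an independent family are independent, and independence of two \<sigma>-algebras passes to
all functions measurable with respect to them.\<close>
lemma indep_var_noise_algebra:
  fixes G H :: "'a \<Rightarrow> real"
  assumes "A \<inter> B = {}" and G: "G \<in> borel_measurable (noise_algebra A)"
    and H: "H \<in> borel_measurable (noise_algebra B)"
  shows "indep_var borel G borel H"
proof -
  have gen: "sigma_sets (space M) {H -` S \<inter> space M |S. S \<in> sets borel} \<subseteq> sets (noise_algebra A)"
    if H: "H \<in> borel_measurable (noise_algebra A)" for H :: "'a \<Rightarrow> real" and A
  proof -
    have "{H -` S \<inter> space M |S. S \<in> sets borel} \<subseteq> sets (noise_algebra A)"
      using measurable_sets[OF H] by (auto simp: space_noise_algebra)
    then show ?thesis
      using sets.sigma_sets_subset[of _ "noise_algebra A"] by (simp add: space_noise_algebra)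
  qed
  have "indep_var (PiM A (\<lambda>_. borel)) (\<lambda>\<omega>. \<lambda>i\<in>A. \<xi> i \<omega>) (PiM B (\<lambda>_. borel)) (\<lambda>\<omega>. \<lambda>i\<in>B. \<xi> i \<omega>)"
    using assms by (intro indep_var_restrict[OF indep]) auto
  then have "indep_set (sets (noise_algebra A)) (sets (noise_algebra B))"
    by (simp add: indep_var_eq noise_algebra_def sets_vimage_algebra)
  then have "indep_set (sigma_sets (space M) {G -` S \<inter> space M |S. S \<in> sets borel})
      (sigma_sets (space M) {H -` S \<inter> space M |S. S \<in> sets borel})"
    using gen[OF G] gen[OF H] unfolding indep_sets2_eq by blast
  then show ?thesis
    using noise_algebra_measurable[OF G] noise_algebra_measurable[OF H] by (simp add: indep_var_eq)
qed

lemma noise_function_integrable: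
  fixes \<phi> :: "real \<Rightarrow> real"
  assumes "\<phi> \<in> borel_measurable borel"
  shows "integrable M (\<lambda>\<omega>. \<phi> (\<xi> k \<omega>)) \<longleftrightarrow> integrable M (\<lambda>\<omega>. \<phi> (\<xi> 0 \<omega>))"
    and "expectation (\<lambda>\<omega>. \<phi> (\<xi> k \<omega>)) = expectation (\<lambda>\<omega>. \<phi> (\<xi> 0 \<omega>))"
proof -
  show "integrable M (\<lambda>\<omega>. \<phi> (\<xi> k \<omega>)) \<longleftrightarrow> integrable M (\<lambda>\<omega>. \<phi> (\<xi> 0 \<omega>))"
    using assms ident[of k] integrable_distr_eq[of "\<xi> k" M borel \<phi>] integrable_distr_eq[of "\<xi> 0" M borel \<phi>]
    by simp
  show "expectation (\<lambda>\<omega>. \<phi> (\<xi> k \<omega>)) = expectation (\<lambda>\<omega>. \<phi> (\<xi> 0 \<omega>))"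
    using assms ident[of k] integral_distr[of "\<xi> k" M borel \<phi>] integral_distr[of "\<xi> 0" M borel \<phi>]
    by simp
qed

lemma noise_int: "integrable M (\<xi> 0)"
  by (rule square_integrable_imp_integrable[OF _ noise_sq_int]) simp

lemma noise_product:
  fixes \<phi> :: "real \<Rightarrow> real"
  assumes \<phi>: "\<phi> \<in> borel_measurable borel" "integrable M (\<lambda>\<omega>. \<phi> (\<xi> 0 \<omega>))"
    and "k \<notin> A" and H: "H \<in> borel_measurable (noise_algebra A)" "integrable M H"
  shows "integrable M (\<lambda>\<omega>. \<phi> (\<xi> k \<omega>) * H \<omega>)"
    and "expectation (\<lambda>\<omega>. \<phi> (\<xi> k \<omega>) * H \<omega>) = expectation (\<lambda>\<omega>. \<phi> (\<xi> 0 \<omega>)) * expectation H"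
proof -
  have "(\<lambda>\<omega>. \<phi> (\<xi> k \<omega>)) \<in> borel_measurable (noise_algebra {k})"
    by (rule measurable_compose[OF noise_measurable_algebra \<phi>(1)]) simp
  then have ind: "indep_var borel (\<lambda>\<omega>. \<phi> (\<xi> k \<omega>)) borel H"
    using assms(3) H(1) by (intro indep_var_noise_algebra[of "{k}" A]) auto
  have int: "integrable M (\<lambda>\<omega>. \<phi> (\<xi> k \<omega>))"
    using noise_function_integrable(1)[OF \<phi>(1)] \<phi>(2) by simp
  show "integrable M (\<lambda>\<omega>. \<phi> (\<xi> k \<omega>) * H \<omega>)"
    by (rule indep_var_integrable[OF ind int H(2)])
  show "expectation (\<lambda>\<omega>. \<phi> (\<xi> k \<omega>) * H \<omega>) = expectation (\<lambda>\<omega>. \<phi> (\<xi> 0 \<omega>)) * expectation H"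
    using indep_var_lebesgue_integral[OF ind int H(2)] noise_function_integrable(2)[OF \<phi>(1), of k]
    by simp
qed

lemma noise_innovation:
  assumes "k \<notin> A" "H \<in> borel_measurable (noise_algebra A)" "integrable M H"
  shows "integrable M (\<lambda>\<omega>. (\<xi> k \<omega> - noise_mean) * H \<omega>)"
    and "expectation (\<lambda>\<omega>. (\<xi> k \<omega> - noise_mean) * H \<omega>) = 0"
  using noise_product[of "\<lambda>x. x - noise_mean", OF _ _ assms] noise_int by (auto simp: prob_space)

lemma noise_square:
  assumes "k \<notin> A" "H \<in> borel_measurable (noise_algebra A)" "square_integrable M H"
  shows "square_integrable M (\<lambda>\<omega>. \<xi> k \<omega> * H \<omega>)"
    and "expectation (\<lambda>\<omega>. (\<xi> k \<omega> * H \<omega>)\<^sup>2) = expectation (\<lambda>\<omega>. (\<xi> 0 \<omega>)\<^sup>2) * expectation (\<lambda>\<omega>. (H \<omega>)\<^sup>2)"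
    and "square_integrable M (\<lambda>\<omega>. (\<xi> k \<omega> - noise_mean) * H \<omega>)"
    and "expectation (\<lambda>\<omega>. ((\<xi> k \<omega> - noise_mean) * H \<omega>)\<^sup>2) = noise_var * expectation (\<lambda>\<omega>. (H \<omega>)\<^sup>2)"
proof -
  have H2: "(\<lambda>\<omega>. (H \<omega>)\<^sup>2) \<in> borel_measurable (noise_algebra A)" "integrable M (\<lambda>\<omega>. (H \<omega>)\<^sup>2)"
    using assms square_integrableD(2)[OF assms(3)] by auto
  have [measurable]: "H \<in> borel_measurable M" by (rule square_integrableD(1)[OF assms(3)])
  note 1 = noise_product[of "\<lambda>x. x\<^sup>2", OF _ noise_sq_int assms(1) H2]
  show "square_integrable M (\<lambda>\<omega>. \<xi> k \<omega> * H \<omega>)"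
    using 1(1) by (simp add: square_integrable_def power_mult_distrib)
  show "expectation (\<lambda>\<omega>. (\<xi> k \<omega> * H \<omega>)\<^sup>2) = expectation (\<lambda>\<omega>. (\<xi> 0 \<omega>)\<^sup>2) * expectation (\<lambda>\<omega>. (H \<omega>)\<^sup>2)"
    using 1(2) by (simp add: power_mult_distrib)
  have int: "integrable M (\<lambda>\<omega>. (\<xi> 0 \<omega> - noise_mean)\<^sup>2)"
    using noise_int noise_sq_int by (simp add: power2_diff)
  have var: "expectation (\<lambda>\<omega>. (\<xi> 0 \<omega> - noise_mean)\<^sup>2) = noise_var"
    using noise_int noise_sq_int by (simp add: variance_eq)
  note 2 = noise_product[of "\<lambda>x. (x - noise_mean)\<^sup>2", OF _ int assms(1) H2]
  show "square_integrable M (\<lambda>\<omega>. (\<xi> k \<omega> - noise_mean) * H \<omega>)"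
    using 2(1) by (simp add: square_integrable_def power_mult_distrib)
  show "expectation (\<lambda>\<omega>. ((\<xi> k \<omega> - noise_mean) * H \<omega>)\<^sup>2) = noise_var * expectation (\<lambda>\<omega>. (H \<omega>)\<^sup>2)"
    using 2(2) var by (simp add: power_mult_distrib)
qed

end

section \<open>Path weights of the iterated recursion\<close>

text \<open>The sum over all strictly increasing paths from 0 to n, where a step from j to i costs b(i-j) and
every visited point j < n contributes a factor x(j). For a constant sequence x this is the sequence z.\<close>
fun path_weight :: "(nat \<Rightarrow> real) \<Rightarrow> (nat \<Rightarrow> real) \<Rightarrow> nat \<Rightarrow> real" where
  "path_weight b x 0 = 1"
| "path_weight b x (Suc n) = (\<Sum>j<Suc n. b (Suc n - j) * (x j * path_weight b x j))"

declare path_weight.simps(2) [simp del]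

lemma path_weight_pos_index:
  "0 < n \<Longrightarrow> path_weight b x n = (\<Sum>j<n. b (n - j) * (x j * path_weight b x j))"
  by (cases n) (auto simp: path_weight.simps(2))

lemma path_weight_nonneg:
  assumes "\<And>j. b (Suc j) \<ge> 0" "\<And>i. x i \<ge> 0"
  shows "path_weight b x n \<ge> 0"
proof (induction n rule: less_induct)
  case (less n)
  have "b j \<ge> 0" if "0 < j" for j using assms(1)[of "j - 1"] that by simp
  with less assms show ?case
    by (cases "n = 0") (auto simp: path_weight_pos_index intro!: sum_nonneg mult_nonneg_nonneg)
qed

text \<open>Writing x(j) = l + (x(j) - l) turns the recursion of the path weights into the renewal recursion of z with the
additional source terms (x(j) - l) W(j), so its solution is the convolution of the sources with z / l. For independent
x with mean l these source terms are orthogonal.\<close>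
lemma path_weight_innovations:
  assumes "l \<noteq> 0"
  shows "path_weight b x n = arch_z l b n +
    (\<Sum>i<n. arch_z l b (n - i) / l * ((x i - l) * path_weight b x i))"
proof (induction n rule: less_induct)
  case (less n)
  show ?case
  proof (cases "n = 0")
    case False
    define e where "e i = (x i - l) * path_weight b x i" for i
    have step: "x j * path_weight b x j = l * arch_z l b j + (\<Sum>i\<le>j. arch_z l b (j - i) * e i)"
      if "j < n" for j
    proof -
      have "x j * path_weight b x j = l * path_weight b x j + e j"
        by (simp add: e_def algebra_simps)
      also have "l * path_weight b x j = l * arch_z l b j + (\<Sum>i<j. arch_z l b (j - i) * e i)"
        unfolding less[OF that] distrib_left sum_distrib_left using \<open>l \<noteq> 0\<close>
        by (simp add: e_def)
      finally show ?thesis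
        by (simp add: lessThan_Suc_atMost[symmetric])
    qed
    have "path_weight b x n =
        (\<Sum>j<n. b (n - j) * (l * arch_z l b j + (\<Sum>i\<le>j. arch_z l b (j - i) * e i)))"
      using False step by (simp add: path_weight_pos_index)
    also have "\<dots> = arch_z l b n + (\<Sum>j<n. \<Sum>i\<le>j. b (n - j) * (arch_z l b (j - i) * e i))"
      using False by (simp add: arch_z_pos_index[of n] distrib_left sum.distrib sum_distrib_left mult_ac)
    also have "(\<Sum>j<n. \<Sum>i\<le>j. b (n - j) * (arch_z l b (j - i) * e i))
        = (\<Sum>(j,i)\<in>(SIGMA j:{..<n}. {..j}). b (n - j) * (arch_z l b (j - i) * e i))"
      by (simp add: sum.Sigma)
    also have "\<dots> = (\<Sum>(i,m)\<in>(SIGMA i:{..<n}. {..<n-i}). b (n - i - m) * (arch_z l b m * e i))"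
      by (rule sum.reindex_bij_witness[of _ "\<lambda>(i,m). (i + m, i)" "\<lambda>(j,i). (i, j - i)"]) auto
    also have "\<dots> = (\<Sum>i<n. (\<Sum>m<n-i. b (n - i - m) * arch_z l b m) * e i)"
      by (simp add: sum.Sigma sum_distrib_right mult.assoc)
    also have "\<dots> = (\<Sum>i<n. arch_z l b (n - i) / l * e i)"
      using \<open>l \<noteq> 0\<close> by (intro sum.cong refl) (simp add: arch_z_pos_index)
    finally show ?thesis by (simp add: e_def)
  qed simp
qed

text \<open>The remainder contains the values of x outside the window {k-N..k}. Enlarging the
window by one means substituting the equation for x(k - N - 1), whose total coefficient in the remainder
is the path weight of N + 1.\<close>
lemma arch_unfold:
  fixes x e :: "int \<Rightarrow> real" and b :: "nat \<Rightarrow> real" and k :: int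
  assumes sm: "\<And>k. summable (\<lambda>j. b (Suc j) * x (k - int (Suc j)))"
    and eq: "\<And>k. x k = (a + (\<Sum>j. b (Suc j) * x (k - int (Suc j)))) * e k"
  defines "V \<equiv> \<lambda>m. e (k - int m) * path_weight b (\<lambda>i. e (k - int i)) m"
    and "T \<equiv> \<lambda>l n. \<Sum>i. b (l + i) * x (n - int (l + i))"
  shows "x k = a * (\<Sum>m<Suc N. V m) + (\<Sum>m<Suc N. V m * T (Suc N - m) (k - int m))"
proof (induction N)
  case 0
  show ?case using eq[of k] by (simp add: V_def T_def algebra_simps)
next
  case (Suc N)
  have T_step: "T (Suc l) n = b (Suc l) * x (n - int (Suc l)) + T (Suc (Suc l)) n" for l n
  proof -
    have "summable (\<lambda>i. b (Suc l + i) * x (n - int (Suc l + i)))"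
      using summable_ignore_initial_segment[OF sm[of n], of l] by (simp add: add.commute)
    from suminf_split_head[OF this] show ?thesis by (simp add: T_def algebra_simps)
  qed
  let ?k = "k - int (Suc N)"
  have T_V: "V m * T (Suc N - m) (k - int m) =
      b (Suc N - m) * V m * x ?k + V m * T (Suc (Suc N) - m) (k - int m)" if "m < Suc N" for m
  proof -
    have "Suc N - m = Suc (N - m)" "Suc (Suc N) - m = Suc (Suc (N - m))"
      "k - int m - int (Suc (N - m)) = ?k" using that by auto
    then show ?thesis using T_step[of "N - m" "k - int m"] by (simp add: algebra_simps)
  qed
  have W: "(\<Sum>m<Suc N. b (Suc N - m) * V m) = path_weight b (\<lambda>i. e (k - int i)) (Suc N)"
    by (simp only: path_weight.simps(2) V_def)
  have "x k = a * (\<Sum>m<Suc N. V m) +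
      (\<Sum>m<Suc N. b (Suc N - m) * V m * x ?k + V m * T (Suc (Suc N) - m) (k - int m))"
    unfolding Suc using T_V by (intro arg_cong2[where f = "(+)"] sum.cong refl) simp
  also have "\<dots> = a * (\<Sum>m<Suc N. V m) + path_weight b (\<lambda>i. e (k - int i)) (Suc N) * x ?k +
      (\<Sum>m<Suc N. V m * T (Suc (Suc N) - m) (k - int m))"
    by (simp only: sum.distrib sum_distrib_right[symmetric] W add.assoc)
  also have "path_weight b (\<lambda>i. e (k - int i)) (Suc N) * x ?k = a * V (Suc N) + V (Suc N) * T 1 ?k"
    unfolding eq[of ?k] by (simp add: V_def T_def algebra_simps)
  finally show ?case by (simp add: algebra_simps)
qed

text \<open>Dominated convergence: every term tends to zero as N grows and is bounded by a multiple of \<bar>v(m)\<bar>.\<close>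
lemma convolution_null:
  fixes v t :: "nat \<Rightarrow> real"
  assumes v: "summable (\<lambda>n. \<bar>v n\<bar>)" and t: "t \<longlonglongrightarrow> 0"
  shows "(\<lambda>N. \<Sum>m<N. v m * t (N - m)) \<longlonglongrightarrow> 0"
proof -
  obtain K where K: "\<And>n. \<bar>t n\<bar> \<le> K"
    using convergent_imp_Bseq[OF convergentI[OF t]] unfolding Bseq_def by auto
  define f where "f m N = (if m < N then v m * t (N - m) else 0)" for m N
  have "(\<lambda>N. f m N) \<longlonglongrightarrow> 0" for m
  proof (rule Lim_transform_eventually)
    have "(\<lambda>N. t (N - m)) \<longlonglongrightarrow> 0"
      by (rule LIMSEQ_offset[where k = m]) (simp add: t)
    then show "(\<lambda>N. v m * t (N - m)) \<longlonglongrightarrow> 0"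
      by (rule tendsto_mult_right_zero)
    show "\<forall>\<^sub>F N in sequentially. v m * t (N - m) = f m N"
      using eventually_gt_at_top[of m] by eventually_elim (simp add: f_def)
  qed
  moreover have "\<forall>\<^sub>F (m, N) in at_top \<times>\<^sub>F sequentially. norm (f m N) \<le> \<bar>v m\<bar> * K"
    using K order_trans[OF abs_ge_zero K]
    by (intro always_eventually) (auto simp: f_def abs_mult intro!: mult_left_mono)
  moreover have "summable (\<lambda>m. \<bar>v m\<bar> * K)" by (intro summable_mult2 v)
  ultimately have "(\<lambda>N. \<Sum>m. f m N) \<longlonglongrightarrow> (\<Sum>m. 0)"
    using tannerys_theorem[of f "\<lambda>_. 0" sequentially "\<lambda>m. \<bar>v m\<bar> * K"] by simp
  moreover have "(\<Sum>m. f m N) = (\<Sum>m<N. v m * t (N - m))" for N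
    by (subst suminf_finite[of "{..<N}"]) (auto simp: f_def)
  ultimately show ?thesis by simp
qed

context iid_noise
begin

text \<open>Path weights run backwards in time from k, so index i stands for the noise at time k - i.\<close>
definition noise_weight :: "(nat \<Rightarrow> real) \<Rightarrow> int \<Rightarrow> nat \<Rightarrow> 'a \<Rightarrow> real" where
  "noise_weight b k n \<omega> = path_weight b (\<lambda>i. \<xi> (k - int i) \<omega>) n"

lemma noise_weight_0 [simp]: "noise_weight b k 0 = (\<lambda>\<omega>. 1)"
  by (simp add: noise_weight_def fun_eq_iff)

lemma noise_weight_pos_index:
  "0 < n \<Longrightarrow> noise_weight b k n =
     (\<lambda>\<omega>. \<Sum>j<n. b (n - j) * (\<xi> (k - int j) \<omega> * noise_weight b k j \<omega>))"
  by (simp add: noise_weight_def fun_eq_iff path_weight_pos_index)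

lemma noise_weight_measurable:
  "noise_weight b k n \<in> borel_measurable (noise_algebra {k - int n<..k})"
proof (induction n rule: less_induct)
  case (less n)
  show ?case
  proof (cases "n = 0")
    case False
    have "noise_weight b k j \<in> borel_measurable (noise_algebra {k - int n<..k})" if "j < n" for j
      using that by (intro noise_algebra_mono[OF _ less]) auto
    with False show ?thesis
      by (auto simp: noise_weight_pos_index intro!: borel_measurable_sum borel_measurable_times
          noise_measurable_algebra)
  qed simp
qed

lemma noise_weight_square_integrable: "square_integrable M (noise_weight b k n)"
proof (induction n rule: less_induct)
  case (less n)
  show ?case
  proof (cases "n = 0")
    case True
    then show ?thesis by (simp add: square_integrable_const finite_measure_axioms)
  next
    case False
    have "square_integrable M (\<lambda>\<omega>. b (n - j) * (\<xi> (k - int j) \<omega> * noise_weight b k j \<omega>))"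
      if "j < n" for j
      by (intro square_integrable_cmult noise_square(1)[OF _ noise_weight_measurable less] that) auto
    with False show ?thesis
      by (auto simp: noise_weight_pos_index intro!: square_integrable_sum finite_measure_axioms)
  qed
qed

lemma noise_weight_innovation:
  shows "square_integrable M (\<lambda>\<omega>. (\<xi> (k - int n) \<omega> - noise_mean) * noise_weight b k n \<omega>)"
    and "expectation (\<lambda>\<omega>. ((\<xi> (k - int n) \<omega> - noise_mean) * noise_weight b k n \<omega>)\<^sup>2)
      = noise_var * expectation (\<lambda>\<omega>. (noise_weight b k n \<omega>)\<^sup>2)"
  using noise_square(3,4)[OF _ noise_weight_measurable noise_weight_square_integrable, of "k - int n" k n b]
  by auto

text \<open>Pythagoras. The factor \<xi>(k-n) - E[\<xi>(0)] is independent of the weight it multiplies and of all earlier terms,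
which involve only the noise at times k-n+1,...,k; so the cross terms vanish.\<close>
lemma innovation_combination:
  fixes b c :: "nat \<Rightarrow> real" and k :: int
  defines "\<eta> \<equiv> \<lambda>i \<omega>. (\<xi> (k - int i) \<omega> - noise_mean) * noise_weight b k i \<omega>"
  shows "expectation (\<lambda>\<omega>. (c0 + (\<Sum>i<n. c i * \<eta> i \<omega>))\<^sup>2) =
    c0\<^sup>2 + noise_var * (\<Sum>i<n. (c i)\<^sup>2 * expectation (\<lambda>\<omega>. (noise_weight b k i \<omega>)\<^sup>2))"
proof (induction n)
  case (Suc n)
  define P where "P \<omega> = c0 + (\<Sum>i<n. c i * \<eta> i \<omega>)" for \<omega>
  have sq_eta: "square_integrable M (\<eta> i)" for i
    unfolding \<eta>_def by (rule noise_weight_innovation)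
  have P: "square_integrable M P"
    unfolding P_def by (intro square_integrable_add square_integrable_const square_integrable_sum
        square_integrable_cmult sq_eta finite_measure_axioms)
  have P_meas: "P \<in> borel_measurable (noise_algebra {k - int n<..k})"
  proof -
    have "noise_weight b k j \<in> borel_measurable (noise_algebra {k - int n<..k})" if "j < n" for j
      using that by (intro noise_algebra_mono[OF _ noise_weight_measurable]) auto
    then show ?thesis
      unfolding P_def \<eta>_def by (intro borel_measurable_add borel_measurable_const borel_measurable_sum
          borel_measurable_times borel_measurable_diff noise_measurable_algebra) auto
  qed
  have PW: "integrable M (\<lambda>\<omega>. P \<omega> * noise_weight b k n \<omega>)"
    by (rule square_integrable_mult[OF P noise_weight_square_integrable])
  have PW_meas: "(\<lambda>\<omega>. P \<omega> * noise_weight b k n \<omega>) \<in> borel_measurable (noise_algebra {k - int n<..k})"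
    by (intro borel_measurable_times P_meas noise_weight_measurable)
  have cross: "expectation (\<lambda>\<omega>. P \<omega> * \<eta> n \<omega>) = 0"
    using noise_innovation(2)[OF _ PW_meas PW, of "k - int n"] by (simp add: \<eta>_def mult_ac)
  have "expectation (\<lambda>\<omega>. (c0 + (\<Sum>i<Suc n. c i * \<eta> i \<omega>))\<^sup>2)
      = expectation (\<lambda>\<omega>. (P \<omega>)\<^sup>2 + ((c n)\<^sup>2 * (\<eta> n \<omega>)\<^sup>2 + 2 * c n * (P \<omega> * \<eta> n \<omega>)))"
    by (intro Bochner_Integration.integral_cong refl) (simp add: P_def power2_eq_square algebra_simps)
  also have "\<dots> = expectation (\<lambda>\<omega>. (P \<omega>)\<^sup>2) + (c n)\<^sup>2 * expectation (\<lambda>\<omega>. (\<eta> n \<omega>)\<^sup>2)"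
    using square_integrableD(2)[OF P] square_integrableD(2)[OF sq_eta]
      square_integrable_mult[OF P sq_eta] cross by simp
  also have "expectation (\<lambda>\<omega>. (\<eta> n \<omega>)\<^sup>2) = noise_var * expectation (\<lambda>\<omega>. (noise_weight b k n \<omega>)\<^sup>2)"
    unfolding \<eta>_def by (rule noise_weight_innovation)
  finally show ?case using Suc by (simp add: P_def algebra_simps)
qed (simp add: prob_space)

text \<open>The renewal equation behind the condition \<Omega> < 1: the mass of its kernel is \<Omega>^2.\<close>
lemma noise_weight_second_moment:
  fixes b :: "nat \<Rightarrow> real" and k :: int
  assumes "noise_mean \<noteq> 0"
  defines "z \<equiv> arch_z noise_mean b"
  defines "u \<equiv> \<lambda>n. expectation (\<lambda>\<omega>. (noise_weight b k n \<omega>)\<^sup>2)"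
  shows "u n = (z n)\<^sup>2 + (\<Sum>i<n. noise_var / noise_mean\<^sup>2 * (z (n - i))\<^sup>2 * u i)"
proof -
  have "noise_weight b k n \<omega> = z n + (\<Sum>i<n. z (n - i) / noise_mean *
      ((\<xi> (k - int i) \<omega> - noise_mean) * noise_weight b k i \<omega>))" for \<omega>
    unfolding noise_weight_def z_def by (rule path_weight_innovations[OF assms(1)])
  then have "u n = (z n)\<^sup>2 + noise_var * (\<Sum>i<n. (z (n - i) / noise_mean)\<^sup>2 * u i)"
    unfolding u_def by (simp only: innovation_combination)
  then show ?thesis by (simp add: sum_distrib_left power_divide mult_ac)
qed

text \<open>In the renewal equation for the second moments, source and kernel are both multiples of z^2 and therefore of order
\<beta>^2, and the kernel has mass below 1. So the second moments are of order \<beta>^2, and their square roots of order \<beta>.\<close>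
lemma noise_weight_L2norm_summable:
  assumes \<beta>: "\<beta> \<in> weight_class 1" "\<And>n. n > 0 \<Longrightarrow> \<beta> n = b n"
    and l: "noise_mean > 0" "noise_mean * arch_coeff_sum b < 1"
    and var: "noise_var \<ge> 0"
      "noise_var / noise_mean\<^sup>2 * (\<Sum>j. (arch_z noise_mean b (Suc j))\<^sup>2) < 1"
  shows "summable (\<lambda>n. L2norm M (noise_weight b k n))"
proof -
  define z where "z = arch_z noise_mean b"
  define q where "q = noise_var / noise_mean\<^sup>2"
  define u where "u n = expectation (\<lambda>\<omega>. (noise_weight b k n \<omega>)\<^sup>2)" for n
  note pos = weight_class_pos[OF \<beta>(1)]
  have q: "q \<ge> 0" using var by (simp add: q_def)
  have "(\<lambda>n. z n / \<beta> n) \<longlonglongrightarrow> noise_mean / (1 - noise_mean * arch_coeff_sum b)\<^sup>2"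
    unfolding z_def by (rule arch_z_asymp[where b = b, OF \<beta> less_imp_le[OF l(1)] l(2)])
  from convergent_imp_Bseq[OF convergentI[OF this]]
  obtain K where K: "K > 0" "\<And>n. norm (z n / \<beta> n) \<le> K"
    unfolding Bseq_def by blast
  have z2: "(z n)\<^sup>2 \<le> K\<^sup>2 * (\<beta> n)\<^sup>2" for n
  proof -
    have "\<bar>z n\<bar> \<le> K * \<beta> n" using K(2)[of n] pos[of n] by (simp add: pos_divide_le_eq)
    then have "\<bar>z n\<bar>\<^sup>2 \<le> (K * \<beta> n)\<^sup>2" by (intro power_mono) auto
    then show ?thesis by (simp add: power_mult_distrib)
  qed
  have z2s: "summable (\<lambda>j. (z (Suc j))\<^sup>2)"
    by (rule summable_comparison_test[of _ "\<lambda>j. K\<^sup>2 * (\<beta> (Suc j))\<^sup>2"])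
       (use z2 weight_class_summable[OF weight_class_sqr[OF \<beta>(1)]]
         in \<open>auto intro!: summable_mult simp: summable_Suc_iff[of "\<lambda>j. (\<beta> j)\<^sup>2"]\<close>)
  have qz: "(\<Sum>j. q * (z (Suc j))\<^sup>2) < 1"
    using var(2) by (simp only: suminf_mult[OF z2s] q_def[symmetric] z_def[symmetric])
  have u_rec: "u n = (z n)\<^sup>2 + (\<Sum>i<n. q * (z (n - i))\<^sup>2 * u i)" for n
    unfolding u_def z_def q_def by (rule noise_weight_second_moment) (use l in simp)
  have qz0: "q * (z (Suc j))\<^sup>2 \<ge> 0" for j using q by simp
  have qz_le: "q * (z (Suc j))\<^sup>2 \<le> (q * K\<^sup>2) * (\<beta> (Suc j))\<^sup>2" for j
    using mult_left_mono[OF z2 q] by (simp add: mult.assoc)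
  have u0: "u n \<ge> 0" for n by (simp add: u_def)
  obtain D where D: "D > 0" "\<And>n. u n \<le> D * (\<beta> n)\<^sup>2"
    using renewal_bounded[where k = "\<lambda>j. q * (z j)\<^sup>2" and f = "\<lambda>n. (z n)\<^sup>2" and u = u
        and C = "q * K\<^sup>2" and F = "K\<^sup>2" and thesis = thesis,
        OF weight_class_sqr[OF \<beta>(1)] qz0 qz_le qz zero_le_power2 z2 u0 u_rec] by metis
  have "L2norm M (noise_weight b k n) \<le> sqrt D * \<beta> n" for n
    using real_sqrt_le_mono[OF D(2)[of n]] pos[of n]
    by (simp add: L2norm_def u_def real_sqrt_mult)
  then show ?thesis
    by (intro summable_comparison_test[OF _ summable_mult[OF weight_class_summable[OF \<beta>(1)], of "sqrt D"]])
       (auto simp: L2norm_nonneg)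
qed

end

section \<open>Stationary solutions are causal\<close>

text \<open>X may depend on the noise in any way, including the future. Summability of the norms of the path weights is
how the condition \<Omega> < 1 and the weight class of b enter.\<close>
locale arch_process = iid_noise M \<xi> for M :: "'a measure" and \<xi> +
  fixes a :: real and b :: "nat \<Rightarrow> real" and X :: "int \<Rightarrow> 'a \<Rightarrow> real"
  assumes noise_nonneg: "\<And>k. AE \<omega> in M. \<xi> k \<omega> \<ge> 0"
    and noise_mean_pos: "noise_mean > 0"
    and noise_var_pos: "noise_var > 0"
    and a_pos: "a > 0"
    and b_nonneg: "\<And>j. b (Suc j) \<ge> 0"
    and b_summable: "summable (\<lambda>j. b (Suc j))"
    and subcritical: "noise_mean * arch_coeff_sum b < 1"
    and weights_summable: "\<And>k. summable (\<lambda>n. L2norm M (noise_weight b k n))"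
    and solution: "arch_solution M a b \<xi> X"
    and stationary: "weakly_stationary M X"
begin

abbreviation vol :: "int \<Rightarrow> 'a \<Rightarrow> real" where "vol \<equiv> arch_volatility a b X"

lemma X_measurable [measurable]: "X k \<in> borel_measurable M"
  using stationary by (simp add: weakly_stationary_def)

lemma X_square_integrable: "square_integrable M (X k)"
  using stationary by (simp add: weakly_stationary_def square_integrable_def)

lemma X_integrable: "integrable M (X k)"
  using stationary by (simp add: weakly_stationary_def)

lemma X_mean: "expectation (X k) = expectation (X 0)"
  using stationary unfolding weakly_stationary_def by blast

lemma covariance_X: "covariance M (X k) (X l) = expectation (\<lambda>\<omega>. X k \<omega> * X l \<omega>) - (expectation (X 0))\<^sup>2"
proof -
  let ?m = "expectation (X 0)"
  have "covariance M (X k) (X l) = expectation (\<lambda>\<omega>. X k \<omega> * X l \<omega> - ?m * X k \<omega> - ?m * X l \<omega> + ?m\<^sup>2)"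
    unfolding covariance_def X_mean[of k] X_mean[of l]
    by (intro Bochner_Integration.integral_cong refl) (simp add: algebra_simps power2_eq_square)
  also have "\<dots> = expectation (\<lambda>\<omega>. X k \<omega> * X l \<omega>) - ?m * ?m - ?m * ?m + ?m\<^sup>2"
    using X_integrable square_integrable_mult[OF X_square_integrable X_square_integrable]
    by (simp add: prob_space X_mean[of k] X_mean[of l])
  finally show ?thesis by (simp add: power2_eq_square)
qed

lemma product_stationary:
  "expectation (\<lambda>\<omega>. X n \<omega> * X (n + k) \<omega>) = expectation (\<lambda>\<omega>. X 0 \<omega> * X k \<omega>)"
proof -
  have "covariance M (X n) (X (n + k)) = covariance M (X 0) (X (0 + k))"
    using stationary unfolding weakly_stationary_def by blast
  then show ?thesis by (simp add: covariance_X)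
qed

lemma X_L2norm: "L2norm M (X k) = L2norm M (X 0)"
  using product_stationary[of k 0] by (simp add: L2norm_def power2_eq_square)

lemma solution_AE:
  "AE \<omega> in M. \<forall>k. summable (\<lambda>j. b (Suc j) * X (k - int (Suc j)) \<omega>) \<and>
      X k \<omega> = (a + (\<Sum>j. b (Suc j) * X (k - int (Suc j)) \<omega>)) * \<xi> k \<omega>"
  using solution by (simp add: arch_solution_def arch_volatility_def)

definition noise_term :: "int \<Rightarrow> nat \<Rightarrow> 'a \<Rightarrow> real" where
  "noise_term k m \<omega> = \<xi> (k - int m) \<omega> * noise_weight b k m \<omega>"

lemma noise_term_square_integrable: "square_integrable M (noise_term k m)"
  and noise_term_L2norm: "L2norm M (noise_term k m) =
    sqrt (expectation (\<lambda>\<omega>. (\<xi> 0 \<omega>)\<^sup>2)) * L2norm M (noise_weight b k m)"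
  using noise_square(1,2)[OF _ noise_weight_measurable noise_weight_square_integrable,
      of "k - int m" k m b]
  by (auto simp: noise_term_def[abs_def] L2norm_def real_sqrt_mult)

lemma noise_term_integrable: "integrable M (noise_term k m)"
  by (rule square_integrable_imp_integrable[OF square_integrableD[OF noise_term_square_integrable]])

lemma noise_term_measurable: "noise_term k m \<in> borel_measurable (noise_algebra {..k})"
  unfolding noise_term_def
  by (intro borel_measurable_times noise_measurable_algebra noise_algebra_mono[OF _ noise_weight_measurable])
     auto

lemma noise_term_nonneg: "AE \<omega> in M. \<forall>m. noise_term k m \<omega> \<ge> 0"
proof -
  have "AE \<omega> in M. \<forall>k. \<xi> k \<omega> \<ge> 0" using noise_nonneg by (simp add: AE_all_countable)
  then show ?thesis
    by eventually_elim
       (auto simp: noise_term_def noise_weight_def intro!: mult_nonneg_nonneg path_weight_nonneg b_nonneg)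
qed

text \<open>In each term of the remainder, the Cauchy-Schwarz inequality separates the path weight from X. This needs no
independence, at the price of L2 norms in place of means of the path weights.\<close>
lemma X_approx_error:
  "(\<integral>\<omega>. \<bar>X k \<omega> - a * (\<Sum>m<Suc N. noise_term k m \<omega>)\<bar> \<partial>M) \<le>
     (\<Sum>m<Suc N. L2norm M (noise_term k m) * L2norm M (X 0) * (\<Sum>i. b (Suc N - m + i)))"
    (is "_ \<le> ?bound")
  and X_approx_integrable: "integrable M (\<lambda>\<omega>. X k \<omega> - a * (\<Sum>m<Suc N. noise_term k m \<omega>))"
proof -
  define f where "f m i \<omega> = noise_term k m \<omega> * X (k - int m - int (Suc N - m + i)) \<omega>" for m i \<omega>
  define R where "R m \<omega> = (\<Sum>i. b (Suc N - m + i) * f m i \<omega>)" for m \<omega>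
  have c: "b (Suc N - m + i) \<ge> 0" "summable (\<lambda>i. b (Suc N - m + i))" if "m < Suc N" for m i
  proof -
    have *: "Suc N - m + i = Suc (i + (N - m))" for i
      using that by auto
    show "b (Suc N - m + i) \<ge> 0" "summable (\<lambda>i. b (Suc N - m + i))"
      unfolding * by (rule b_nonneg summable_ignore_initial_segment[OF b_summable])+
  qed
  have f: "integrable M (f m i)" "(\<integral>\<omega>. \<bar>f m i \<omega>\<bar> \<partial>M) \<le> L2norm M (noise_term k m) * L2norm M (X 0)" for m i
  proof -
    show "integrable M (f m i)"
      unfolding f_def by (rule square_integrable_mult[OF noise_term_square_integrable X_square_integrable])
    show "(\<integral>\<omega>. \<bar>f m i \<omega>\<bar> \<partial>M) \<le> L2norm M (noise_term k m) * L2norm M (X 0)"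
      unfolding f_def X_L2norm[of "k - int m - int (Suc N - m + i)", symmetric]
      by (rule Cauchy_Schwarz_L2[OF noise_term_square_integrable X_square_integrable])
  qed
  have R_int: "integrable M (R m)" if "m < Suc N" for m
    unfolding R_def by (rule weighted_series_integrable[OF c[OF that] f])
  have R_le: "(\<integral>\<omega>. \<bar>R m \<omega>\<bar> \<partial>M) \<le> L2norm M (noise_term k m) * L2norm M (X 0) * (\<Sum>i. b (Suc N - m + i))"
    if "m < Suc N" for m
    unfolding R_def by (rule weighted_series_bound[OF c[OF that] f])
  show int: "integrable M (\<lambda>\<omega>. X k \<omega> - a * (\<Sum>m<Suc N. noise_term k m \<omega>))"
    by (intro Bochner_Integration.integrable_diff X_integrable integrable_mult_right
        Bochner_Integration.integrable_sum noise_term_integrable)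
  have "AE \<omega> in M. X k \<omega> - a * (\<Sum>m<Suc N. noise_term k m \<omega>) = (\<Sum>m<Suc N. R m \<omega>)"
    using solution_AE
  proof eventually_elim
    case (elim \<omega>)
    have sm: "summable (\<lambda>j. b (Suc j) * X (k - int (Suc j)) \<omega>)"
      and eq: "X k \<omega> = (a + (\<Sum>j. b (Suc j) * X (k - int (Suc j)) \<omega>)) * \<xi> k \<omega>" for k
      using elim by blast+
    have "X k \<omega> = a * (\<Sum>m<Suc N. noise_term k m \<omega>) + (\<Sum>m<Suc N. noise_term k m \<omega> *
        (\<Sum>i. b (Suc N - m + i) * X (k - int m - int (Suc N - m + i)) \<omega>))"
      unfolding noise_term_def noise_weight_def by (rule arch_unfold[OF sm eq])
    then have "X k \<omega> - a * (\<Sum>m<Suc N. noise_term k m \<omega>) = (\<Sum>m<Suc N. noise_term k m \<omega> *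
        (\<Sum>i. b (Suc N - m + i) * X (k - int m - int (Suc N - m + i)) \<omega>))"
      by linarith
    also have "\<dots> = (\<Sum>m<Suc N. R m \<omega>)"
    proof (rule sum.cong[OF refl])
      fix m assume "m \<in> {..<Suc N}"
      then have *: "Suc N - m + i = Suc (i + (N - m))" for i by auto
      have "summable (\<lambda>i. b (Suc N - m + i) * X (k - int m - int (Suc N - m + i)) \<omega>)"
        unfolding * by (rule summable_ignore_initial_segment[OF sm])
      from suminf_mult[OF this, of "noise_term k m \<omega>"]
      show "noise_term k m \<omega> * (\<Sum>i. b (Suc N - m + i) * X (k - int m - int (Suc N - m + i)) \<omega>) = R m \<omega>"
        by (simp add: R_def f_def mult_ac)
    qed
    finally show ?case .
  qed
  then have le: "AE \<omega> in M. \<bar>X k \<omega> - a * (\<Sum>m<Suc N. noise_term k m \<omega>)\<bar> \<le> (\<Sum>m<Suc N. \<bar>R m \<omega>\<bar>)"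
  proof eventually_elim
    case (elim \<omega>)
    show ?case unfolding elim by (rule sum_abs)
  qed
  have R_abs: "integrable M (\<lambda>\<omega>. \<bar>R m \<omega>\<bar>)" if "m \<in> {..<Suc N}" for m
    using R_int[of m] that by simp
  have sum_int: "integrable M (\<lambda>\<omega>. \<Sum>m<Suc N. \<bar>R m \<omega>\<bar>)"
    by (rule Bochner_Integration.integrable_sum[OF R_abs])
  have "(\<integral>\<omega>. \<bar>X k \<omega> - a * (\<Sum>m<Suc N. noise_term k m \<omega>)\<bar> \<partial>M)
      \<le> (\<integral>\<omega>. (\<Sum>m<Suc N. \<bar>R m \<omega>\<bar>) \<partial>M)"
    by (rule integral_mono_AE[OF integrable_abs[OF int] sum_int le])
  also have "\<dots> = (\<Sum>m<Suc N. \<integral>\<omega>. \<bar>R m \<omega>\<bar> \<partial>M)"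
    by (rule Bochner_Integration.integral_sum[OF R_abs])
  also have "\<dots> \<le> ?bound" using R_le by (intro sum_mono) auto
  finally show "(\<integral>\<omega>. \<bar>X k \<omega> - a * (\<Sum>m<Suc N. noise_term k m \<omega>)\<bar> \<partial>M) \<le> ?bound" .
qed

lemma X_series_L1:
  "(\<lambda>N. \<integral>\<omega>. norm (X k \<omega> - a * (\<Sum>m<Suc N. noise_term k m \<omega>)) \<partial>M) \<longlonglongrightarrow> 0"
proof -
  define v where "v m = L2norm M (noise_term k m) * L2norm M (X 0)" for m
  define t where "t l = (\<Sum>i. b (l + i))" for l
  have "summable (\<lambda>m. \<bar>v m\<bar>)"
    unfolding v_def noise_term_L2norm
    using summable_mult[OF weights_summable[of k], of "sqrt (expectation (\<lambda>\<omega>. (\<xi> 0 \<omega>)\<^sup>2)) * L2norm M (X 0)"]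
    by (simp add: abs_mult L2norm_nonneg mult_ac)
  moreover have "t \<longlonglongrightarrow> 0"
  proof -
    have "(\<lambda>l. \<Sum>i. b (Suc (i + l))) \<longlonglongrightarrow> 0"
      using suminf_exist_split2[OF b_summable] by simp
    then have "(\<lambda>l. t (Suc l)) \<longlonglongrightarrow> 0" by (simp add: t_def add.commute)
    then show ?thesis by (rule LIMSEQ_imp_Suc)
  qed
  ultimately have "(\<lambda>N. \<Sum>m<N. v m * t (N - m)) \<longlonglongrightarrow> 0" by (rule convolution_null)
  then have "(\<lambda>N. \<Sum>m<Suc N. v m * t (Suc N - m)) \<longlonglongrightarrow> 0" by (rule LIMSEQ_Suc)
  moreover have "(\<integral>\<omega>. norm (X k \<omega> - a * (\<Sum>m<Suc N. noise_term k m \<omega>)) \<partial>M)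
      \<le> (\<Sum>m<Suc N. v m * t (Suc N - m))" for N
    using X_approx_error[of k N] unfolding v_def t_def real_norm_def .
  then have "\<forall>\<^sub>F N in sequentially.
      norm (\<integral>\<omega>. norm (X k \<omega> - a * (\<Sum>m<Suc N. noise_term k m \<omega>)) \<partial>M)
        \<le> (\<Sum>m<Suc N. v m * t (Suc N - m))"
    by (intro always_eventually allI) (simp only: real_norm_def abs_of_nonneg integral_nonneg_AE AE_I2 abs_ge_zero)
  ultimately show ?thesis by (rule Lim_null_comparison[rotated])
qed

text \<open>Only the almost sure equality class matters, because the equations hold almost surely.\<close>
definition causal :: "int \<Rightarrow> ('a \<Rightarrow> real) \<Rightarrow> bool" where
  "causal k Y \<longleftrightarrow> (\<exists>Y' \<in> borel_measurable (noise_algebra {..k}). AE \<omega> in M. Y \<omega> = Y' \<omega>)"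

lemma causalI:
  "Y' \<in> borel_measurable (noise_algebra {..k}) \<Longrightarrow> AE \<omega> in M. Y \<omega> = Y' \<omega> \<Longrightarrow> causal k Y"
  unfolding causal_def by (rule bexI)

lemma causal_mono: "k \<le> l \<Longrightarrow> causal k Y \<Longrightarrow> causal l Y"
  unfolding causal_def by (meson noise_algebra_mono atMost_subset_iff)

lemma causal_affine:
  assumes "causal k Y" "causal k Z"
  shows "causal k (\<lambda>\<omega>. Y \<omega> - c * Z \<omega>)"
proof -
  from assms obtain Y' Z' where
    [measurable]: "Y' \<in> borel_measurable (noise_algebra {..k})" "Z' \<in> borel_measurable (noise_algebra {..k})"
    and AE: "AE \<omega> in M. Y \<omega> = Y' \<omega>" "AE \<omega> in M. Z \<omega> = Z' \<omega>"
    by (auto simp: causal_def)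
  have "(\<lambda>\<omega>. Y' \<omega> - c * Z' \<omega>) \<in> borel_measurable (noise_algebra {..k})" by measurable
  moreover have "AE \<omega> in M. Y \<omega> - c * Z \<omega> = Y' \<omega> - c * Z' \<omega>"
    using AE by eventually_elim simp
  ultimately show ?thesis by (rule causalI)
qed

lemma causal_mult:
  assumes "causal k Y" "causal k Z"
  shows "causal k (\<lambda>\<omega>. Y \<omega> * Z \<omega>)"
proof -
  from assms obtain Y' Z' where
    [measurable]: "Y' \<in> borel_measurable (noise_algebra {..k})" "Z' \<in> borel_measurable (noise_algebra {..k})"
    and AE: "AE \<omega> in M. Y \<omega> = Y' \<omega>" "AE \<omega> in M. Z \<omega> = Z' \<omega>"
    by (auto simp: causal_def)
  have "(\<lambda>\<omega>. Y' \<omega> * Z' \<omega>) \<in> borel_measurable (noise_algebra {..k})" by measurable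
  moreover have "AE \<omega> in M. Y \<omega> * Z \<omega> = Y' \<omega> * Z' \<omega>"
    using AE by eventually_elim simp
  ultimately show ?thesis by (rule causalI)
qed

text \<open>Along a subsequence, X(k) is the almost sure limit of the truncated expansions; these are non-negative and
involve only the noise up to time k.\<close>
lemma X_causal_nonneg:
  shows X_causal: "causal k (X k)" and X_nonneg: "AE \<omega> in M. X k \<omega> \<ge> 0"
proof -
  from tendsto_L1_AE_subseq[OF X_approx_integrable X_series_L1[of k]]
  obtain r where r: "AE \<omega> in M. (\<lambda>n. X k \<omega> - a * (\<Sum>m<Suc (r n). noise_term k m \<omega>)) \<longlonglongrightarrow> 0"
    by blast
  have lim: "AE \<omega> in M. (\<lambda>n. a * (\<Sum>m<Suc (r n). noise_term k m \<omega>)) \<longlonglongrightarrow> X k \<omega>"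
    using r
  proof eventually_elim
    case (elim \<omega>)
    from tendsto_diff[OF tendsto_const[of "X k \<omega>"] elim] show ?case by simp
  qed
  define Y where "Y \<omega> = lim (\<lambda>n. a * (\<Sum>m<Suc (r n). noise_term k m \<omega>))" for \<omega>
  have "Y \<in> borel_measurable (noise_algebra {..k})"
    unfolding Y_def
    by (intro borel_measurable_lim_metric borel_measurable_times borel_measurable_const
        borel_measurable_sum noise_term_measurable)
  moreover have "AE \<omega> in M. X k \<omega> = Y \<omega>"
    using lim unfolding Y_def by eventually_elim (rule limI[symmetric])
  ultimately show "causal k (X k)" by (auto simp: causal_def)
  show "AE \<omega> in M. X k \<omega> \<ge> 0"
    using lim noise_term_nonneg[of k]
  proof eventually_elim
    case (elim \<omega>)
    have "0 \<le> a * (\<Sum>m<Suc (r n). noise_term k m \<omega>)" for n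
      using a_pos elim(2) by (intro mult_nonneg_nonneg sum_nonneg) auto
    then show ?case by (intro LIMSEQ_le_const[OF elim(1)]) blast
  qed
qed

section \<open>The autocovariance of a stationary solution\<close>

lemma vol_causal: "causal (k - 1) (vol k)"
proof -
  have "\<forall>j. \<exists>Y' \<in> borel_measurable (noise_algebra {..k-1}). AE \<omega> in M. X (k - int (Suc j)) \<omega> = Y' \<omega>"
    using causal_mono[OF _ X_causal, of _ "k - 1"] by (simp add: causal_def)
  then obtain Y where Y: "\<And>j. Y j \<in> borel_measurable (noise_algebra {..k-1})"
    and AE: "\<And>j. AE \<omega> in M. X (k - int (Suc j)) \<omega> = Y j \<omega>"
    by metis
  have "(\<lambda>\<omega>. a + (\<Sum>j. b (Suc j) * Y j \<omega>)) \<in> borel_measurable (noise_algebra {..k-1})"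
    using Y by (intro borel_measurable_add borel_measurable_const borel_measurable_suminf
        borel_measurable_times)
  moreover have "AE \<omega> in M. \<forall>j. X (k - int (Suc j)) \<omega> = Y j \<omega>"
    using AE by (simp add: AE_all_countable)
  then have "AE \<omega> in M. vol k \<omega> = a + (\<Sum>j. b (Suc j) * Y j \<omega>)"
    by eventually_elim (simp add: arch_volatility_def)
  ultimately show ?thesis by (rule causalI)
qed

lemma vol_square_integrable: "square_integrable M (vol k)"
proof -
  have "AE \<omega> in M. summable (\<lambda>j. b (Suc j) * X (k - int (Suc j)) \<omega>)"
    using solution_AE by eventually_elim blast
  moreover have "(\<integral>\<omega>. (X l \<omega>)\<^sup>2 \<partial>M) \<le> (\<integral>\<omega>. (X 0 \<omega>)\<^sup>2 \<partial>M)" for l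
    using X_L2norm[of l] by (simp add: L2norm_def)
  ultimately have "square_integrable M (\<lambda>\<omega>. \<Sum>j. b (Suc j) * X (k - int (Suc j)) \<omega>)"
    by (intro weighted_series_square_integrable[OF b_nonneg b_summable X_square_integrable])
  from square_integrable_add[OF square_integrable_const[OF finite_measure_axioms] this]
  show ?thesis by (simp add: arch_volatility_def[abs_def])
qed

text \<open>The definition of the volatility may be integrated term by term against a square-integrable function.\<close>
lemma vol_times:
  assumes Y: "square_integrable M Y"
  shows "(\<lambda>j. b (Suc j) * expectation (\<lambda>\<omega>. X (k - int (Suc j)) \<omega> * Y \<omega>)) sums
      (expectation (\<lambda>\<omega>. vol k \<omega> * Y \<omega>) - a * expectation Y)"
proof -
  let ?f = "\<lambda>j \<omega>. X (k - int (Suc j)) \<omega> * Y \<omega>"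
  have f: "integrable M (?f j)" "(\<integral>\<omega>. \<bar>?f j \<omega>\<bar> \<partial>M) \<le> L2norm M (X 0) * L2norm M Y" for j
    using square_integrable_mult[OF X_square_integrable Y]
      Cauchy_Schwarz_L2[OF X_square_integrable[of "k - int (Suc j)"] Y]
    by (simp_all only: X_L2norm[of "k - int (Suc j)"])
  have Y_int: "integrable M Y"
    by (rule square_integrable_imp_integrable[OF square_integrableD[OF Y]])
  have "AE \<omega> in M. (\<Sum>j. b (Suc j) * ?f j \<omega>) = vol k \<omega> * Y \<omega> - a * Y \<omega>"
    using solution_AE
  proof eventually_elim
    case (elim \<omega>)
    then have "summable (\<lambda>j. b (Suc j) * X (k - int (Suc j)) \<omega>)" by blast
    from suminf_mult2[OF this, of "Y \<omega>"]
    show ?case by (simp add: arch_volatility_def algebra_simps)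
  qed
  moreover have "(\<lambda>\<omega>. \<Sum>j. b (Suc j) * ?f j \<omega>) \<in> borel_measurable M"
    by (rule borel_measurable_integrable[OF weighted_series_integrable[where f = ?f, OF b_nonneg b_summable f]])
  moreover have vol_int: "integrable M (\<lambda>\<omega>. vol k \<omega> * Y \<omega>)"
    by (rule square_integrable_mult[OF vol_square_integrable Y])
  then have "(\<lambda>\<omega>. vol k \<omega> * Y \<omega> - a * Y \<omega>) \<in> borel_measurable M"
    using Y_int by (intro borel_measurable_integrable Bochner_Integration.integrable_diff) auto
  ultimately have "expectation (\<lambda>\<omega>. \<Sum>j. b (Suc j) * ?f j \<omega>) = expectation (\<lambda>\<omega>. vol k \<omega> * Y \<omega> - a * Y \<omega>)"
    by (intro integral_cong_AE)
  also have "\<dots> = expectation (\<lambda>\<omega>. vol k \<omega> * Y \<omega>) - a * expectation Y"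
    using vol_int Y_int by simp
  finally have eq: "expectation (\<lambda>\<omega>. \<Sum>j. b (Suc j) * ?f j \<omega>) =
      expectation (\<lambda>\<omega>. vol k \<omega> * Y \<omega>) - a * expectation Y" .
  show ?thesis
    unfolding eq[symmetric] by (rule weighted_series_sums[where f = ?f, OF b_nonneg b_summable f])
qed

lemma vol_ge: "AE \<omega> in M. vol k \<omega> \<ge> a"
proof -
  have "AE \<omega> in M. \<forall>k. X k \<omega> \<ge> 0" using X_nonneg by (simp add: AE_all_countable)
  with solution_AE show ?thesis
  proof eventually_elim
    case (elim \<omega>)
    then have "summable (\<lambda>j. b (Suc j) * X (k - int (Suc j)) \<omega>)" by blast
    then have "0 \<le> (\<Sum>j. b (Suc j) * X (k - int (Suc j)) \<omega>)"
      using elim(2) b_nonneg by (intro suminf_nonneg) auto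
    then show ?case by (simp add: arch_volatility_def)
  qed
qed

abbreviation nu :: "int \<Rightarrow> 'a \<Rightarrow> real" where "nu \<equiv> arch_nu noise_mean a b X"

lemma nu_square_integrable: "square_integrable M (nu k)"
  unfolding arch_nu_def[abs_def]
  by (intro square_integrable_diff square_integrable_cmult X_square_integrable vol_square_integrable)

lemma nu_causal: "causal k (nu k)"
  unfolding arch_nu_def[abs_def] by (intro causal_affine X_causal causal_mono[OF _ vol_causal]) simp

lemma nu_AE: "AE \<omega> in M. nu k \<omega> = (\<xi> k \<omega> - noise_mean) * vol k \<omega>"
  using solution_AE
proof eventually_elim
  case (elim \<omega>)
  then have "X k \<omega> = (a + (\<Sum>j. b (Suc j) * X (k - int (Suc j)) \<omega>)) * \<xi> k \<omega>" by blast
  then have "X k \<omega> = vol k \<omega> * \<xi> k \<omega>" by (simp only: arch_volatility_def)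
  then show ?case by (simp add: arch_nu_def algebra_simps)
qed

text \<open>Here \<nu>(k) Y = (\<xi>(k) - E[\<xi>(0)]) (\<varsigma>(k) Y) with the volatility \<varsigma>(k), and the second factor depends on the noise
before time k only, so it is independent of \<xi>(k).\<close>
lemma nu_orthogonal:
  assumes Y: "square_integrable M Y" "causal (k - 1) Y"
  shows "expectation (\<lambda>\<omega>. nu k \<omega> * Y \<omega>) = 0"
proof -
  have "causal (k - 1) (\<lambda>\<omega>. vol k \<omega> * Y \<omega>)" by (intro causal_mult vol_causal Y)
  then obtain H where H: "H \<in> borel_measurable (noise_algebra {..k-1})"
    and AE: "AE \<omega> in M. vol k \<omega> * Y \<omega> = H \<omega>"
    by (auto simp: causal_def)
  have H_int: "integrable M H"
    by (rule integrable_cong_AE_imp[OF square_integrable_mult[OF vol_square_integrable Y(1)]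
          noise_algebra_measurable[OF H]]) (use AE in \<open>auto elim: eventually_mono\<close>)
  note inn = noise_innovation[OF _ H H_int, of k]
  have "AE \<omega> in M. nu k \<omega> * Y \<omega> = (\<xi> k \<omega> - noise_mean) * H \<omega>"
    using nu_AE[of k] AE by eventually_elim (simp add: mult.assoc)
  moreover have "(\<lambda>\<omega>. nu k \<omega> * Y \<omega>) \<in> borel_measurable M"
    by (rule borel_measurable_integrable[OF square_integrable_mult[OF nu_square_integrable Y(1)]])
  moreover have "(\<lambda>\<omega>. (\<xi> k \<omega> - noise_mean) * H \<omega>) \<in> borel_measurable M"
    by (rule borel_measurable_integrable[OF inn(1)]) simp
  ultimately have "expectation (\<lambda>\<omega>. nu k \<omega> * Y \<omega>) = expectation (\<lambda>\<omega>. (\<xi> k \<omega> - noise_mean) * H \<omega>)"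
    by (intro integral_cong_AE)
  then show ?thesis using inn(2) by simp
qed

lemma nu_mean: "expectation (nu k) = 0"
proof -
  have "causal (k - 1) (\<lambda>\<omega>. 1)" unfolding causal_def by (rule bexI[of _ "\<lambda>_. 1"]) auto
  from nu_orthogonal[OF square_integrable_const[OF finite_measure_axioms] this] show ?thesis by simp
qed

definition nu_var :: real where "nu_var = expectation (\<lambda>\<omega>. (nu 0 \<omega>)\<^sup>2)"

text \<open>As the volatility is at least a > 0, vanishing of \<nu>(0) would make \<xi>(0) constant.\<close>
lemma nu_var_pos: "nu_var > 0"
proof (rule ccontr)
  assume "\<not> nu_var > 0"
  moreover have "nu_var \<ge> 0" by (simp add: nu_var_def)
  ultimately have "nu_var = 0" by simp
  then have "AE \<omega> in M. (nu 0 \<omega>)\<^sup>2 = 0"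
    unfolding nu_var_def
    using integral_nonneg_eq_0_iff_AE[OF square_integrableD(2)[OF nu_square_integrable[of 0]]] by simp
  with nu_AE[of 0] vol_ge[of 0] have "AE \<omega> in M. \<xi> 0 \<omega> = noise_mean"
    by eventually_elim (use a_pos in auto)
  then have "expectation (\<lambda>\<omega>. (\<xi> 0 \<omega>)\<^sup>2) = expectation (\<lambda>\<omega>. noise_mean\<^sup>2)"
    by (intro integral_cong_AE) auto
  then show False using noise_var_pos by (simp add: prob_space)
qed

text \<open>Multiplying X(k) = \<lambda> \<varsigma>(k) + \<nu>(k) by \<nu>(0), with \<lambda> the mean of the noise and \<varsigma> the volatility, and taking expectations gives
the recursion that defines z, started at v for k = 0 and with value 0 for k < 0.\<close>
lemma nu_X_cross:
  "expectation (\<lambda>\<omega>. X k \<omega> * nu 0 \<omega>) = (if k < 0 then 0 else nu_var * arch_z noise_mean b (nat k))"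
proof -
  define r where "r k = expectation (\<lambda>\<omega>. X k \<omega> * nu 0 \<omega>)" for k
  have neg: "r k = 0" if "k < 0" for k
  proof -
    have "causal (0 - 1) (X k)" by (rule causal_mono[OF _ X_causal]) (use that in simp)
    from nu_orthogonal[OF X_square_integrable this] show ?thesis
      by (simp add: r_def mult.commute)
  qed
  have rec: "r k = noise_mean * (\<Sum>j. b (Suc j) * r (k - int (Suc j))) + expectation (\<lambda>\<omega>. nu k \<omega> * nu 0 \<omega>)" for k
  proof -
    have "r k = expectation (\<lambda>\<omega>. noise_mean * (vol k \<omega> * nu 0 \<omega>) + nu k \<omega> * nu 0 \<omega>)"
      unfolding r_def by (intro Bochner_Integration.integral_cong refl) (simp add: arch_nu_def algebra_simps)
    also have "\<dots> = noise_mean * expectation (\<lambda>\<omega>. vol k \<omega> * nu 0 \<omega>) + expectation (\<lambda>\<omega>. nu k \<omega> * nu 0 \<omega>)"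
      using square_integrable_mult[OF vol_square_integrable nu_square_integrable]
        square_integrable_mult[OF nu_square_integrable nu_square_integrable] by simp
    also have "expectation (\<lambda>\<omega>. vol k \<omega> * nu 0 \<omega>) = (\<Sum>j. b (Suc j) * r (k - int (Suc j)))"
      using vol_times[OF nu_square_integrable[of 0], of k] nu_mean[of 0]
      unfolding r_def by (simp only: mult_zero_right diff_zero sums_iff)
    finally show ?thesis .
  qed
  have nat: "r (int n) = nu_var * arch_z noise_mean b n" for n
  proof (induction n rule: less_induct)
    case (less n)
    show ?case
    proof (cases n)
      case 0
      have "(\<Sum>j. b (Suc j) * r (0 - int (Suc j))) = 0" using neg by simp
      then show ?thesis using rec[of 0] 0 by (simp add: nu_var_def power2_eq_square)
    next
      case (Suc m)
      have "causal (int n - 1) (nu 0)" by (rule causal_mono[OF _ nu_causal]) (simp add: Suc)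
      then have orth: "expectation (\<lambda>\<omega>. nu (int n) \<omega> * nu 0 \<omega>) = 0"
        by (rule nu_orthogonal[OF nu_square_integrable])
      have "(\<Sum>j. b (Suc j) * r (int n - int (Suc j))) = (\<Sum>j<Suc m. b (Suc j) * r (int n - int (Suc j)))"
        by (rule suminf_finite) (auto simp: Suc intro!: neg)
      also have "\<dots> = (\<Sum>j<Suc m. b (Suc j) * (nu_var * arch_z noise_mean b (m - j)))"
      proof (intro sum.cong refl)
        fix j assume j: "j \<in> {..<Suc m}"
        then have "int n - int (Suc j) = int (m - j)" "m - j < n" by (auto simp: Suc)
        then show "b (Suc j) * r (int n - int (Suc j)) = b (Suc j) * (nu_var * arch_z noise_mean b (m - j))"
          using less by simp
      qed
      also have "\<dots> = (\<Sum>j<Suc m. b (Suc m - j) * (nu_var * arch_z noise_mean b j))"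
        by (subst sum.nat_diff_reindex[symmetric]) (auto intro!: sum.cong simp: Suc_diff_le)
      also have "noise_mean * \<dots> = nu_var * arch_z noise_mean b (Suc m)"
        by (simp only: arch_z.simps(2) sum_distrib_left mult.left_commute)
      finally show ?thesis using rec[of "int n"] orth by (simp add: Suc)
    qed
  qed
  show ?thesis
  proof (cases "k < 0")
    case False
    then show ?thesis using nat[of "nat k"] by (simp add: r_def)
  qed (use neg[of k] in \<open>simp add: r_def\<close>)
qed

lemma autocovariance_eq: "autocovariance M X k = expectation (\<lambda>\<omega>. X 0 \<omega> * X k \<omega>) - (expectation (X 0))\<^sup>2"
  by (simp add: autocovariance_def covariance_X)

lemma autocovariance_even: "autocovariance M X (- k) = autocovariance M X k"
  using product_stationary[of k "- k"] by (simp add: autocovariance_eq mult.commute)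

lemma autocovariance_bounded: "\<bar>autocovariance M X k\<bar> \<le> (L2norm M (X 0))\<^sup>2 + (expectation (X 0))\<^sup>2"
proof -
  have "\<bar>expectation (\<lambda>\<omega>. X 0 \<omega> * X k \<omega>)\<bar> \<le> (\<integral>\<omega>. \<bar>X 0 \<omega> * X k \<omega>\<bar> \<partial>M)"
    by (rule integral_abs_bound)
  also have "\<dots> \<le> L2norm M (X 0) * L2norm M (X k)"
    by (rule Cauchy_Schwarz_L2[OF X_square_integrable X_square_integrable])
  finally have "\<bar>expectation (\<lambda>\<omega>. X 0 \<omega> * X k \<omega>)\<bar> \<le> (L2norm M (X 0))\<^sup>2"
    using X_L2norm[of k] by (simp add: power2_eq_square)
  moreover have "0 \<le> (expectation (X 0))\<^sup>2" by simp
  ultimately show ?thesis unfolding autocovariance_eq by linarith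
qed

lemma X_mean_equation:
  "expectation (X 0) = noise_mean * (a + arch_coeff_sum b * expectation (X 0))"
proof -
  have vol_int: "integrable M (vol 0)"
    by (rule square_integrable_imp_integrable[OF square_integrableD[OF vol_square_integrable]])
  have "0 = expectation (X 0) - noise_mean * expectation (vol 0)"
    using nu_mean[of 0] X_integrable[of 0] vol_int by (simp add: arch_nu_def[abs_def])
  moreover have "(\<lambda>j. b (Suc j) * expectation (X 0)) sums (expectation (vol 0) - a)"
    using vol_times[OF square_integrable_const[OF finite_measure_axioms, of 1], of 0]
    by (simp add: prob_space X_mean[of "- 1 - int _"] X_mean[of "- (1 + int _)"])
  moreover have "(\<lambda>j. b (Suc j) * expectation (X 0)) sums (arch_coeff_sum b * expectation (X 0))"
    unfolding arch_coeff_sum_def by (intro sums_mult2 summable_sums b_summable)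
  ultimately show ?thesis using sums_unique2 by (metis add.commute diff_add_cancel diff_eq_diff_eq diff_self)
qed

text \<open>Expand the factor X(0) = \<lambda> \<varsigma>(0) + \<nu>(0) in E[X(0) X(k)]. By stationarity the product moment of X(-j) and X(k) is
that of lag k+j, and the terms with the mean of X cancel by the equation for the mean.\<close>
lemma autocovariance_recursion:
  "autocovariance M X (int k) = nu_var * arch_z noise_mean b k +
     (\<Sum>j. noise_mean * b (Suc j) * autocovariance M X (int (k + Suc j)))"
proof -
  define m where "m = expectation (X 0)"
  let ?\<rho> = "autocovariance M X"
  have "(\<lambda>j. b (Suc j) * expectation (\<lambda>\<omega>. X (0 - int (Suc j)) \<omega> * X (int k) \<omega>)) sums
      (expectation (\<lambda>\<omega>. vol 0 \<omega> * X (int k) \<omega>) - a * m)"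
    unfolding m_def X_mean[of "int k", symmetric] by (rule vol_times[OF X_square_integrable])
  moreover have "expectation (\<lambda>\<omega>. X (0 - int (Suc j)) \<omega> * X (int k) \<omega>) = ?\<rho> (int (k + Suc j)) + m\<^sup>2" for j
    using product_stationary[of "0 - int (Suc j)" "int (k + Suc j)"] by (simp add: autocovariance_eq m_def)
  ultimately have "(\<lambda>j. b (Suc j) * (?\<rho> (int (k + Suc j)) + m\<^sup>2)) sums
      (expectation (\<lambda>\<omega>. vol 0 \<omega> * X (int k) \<omega>) - a * m)" by (simp only:)
  moreover have "(\<lambda>j. b (Suc j) * m\<^sup>2) sums (arch_coeff_sum b * m\<^sup>2)"
    unfolding arch_coeff_sum_def by (intro sums_mult2 summable_sums b_summable)
  ultimately have "(\<lambda>j. b (Suc j) * (?\<rho> (int (k + Suc j)) + m\<^sup>2) - b (Suc j) * m\<^sup>2) sums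
      (expectation (\<lambda>\<omega>. vol 0 \<omega> * X (int k) \<omega>) - a * m - arch_coeff_sum b * m\<^sup>2)"
    by (rule sums_diff)
  then have "(\<lambda>j. noise_mean * (b (Suc j) * ?\<rho> (int (k + Suc j)))) sums
      (noise_mean * (expectation (\<lambda>\<omega>. vol 0 \<omega> * X (int k) \<omega>) - a * m - arch_coeff_sum b * m\<^sup>2))"
    by (intro sums_mult) (simp add: algebra_simps)
  then have ser: "(\<Sum>j. noise_mean * b (Suc j) * ?\<rho> (int (k + Suc j))) =
      noise_mean * expectation (\<lambda>\<omega>. vol 0 \<omega> * X (int k) \<omega>) - m * (noise_mean * (a + arch_coeff_sum b * m))"
    by (simp only: sums_iff mult.assoc) (simp add: algebra_simps power2_eq_square)
  have "expectation (\<lambda>\<omega>. X 0 \<omega> * X (int k) \<omega>) =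
      expectation (\<lambda>\<omega>. noise_mean * (vol 0 \<omega> * X (int k) \<omega>) + X (int k) \<omega> * nu 0 \<omega>)"
    by (intro Bochner_Integration.integral_cong refl) (simp add: arch_nu_def algebra_simps)
  also have "\<dots> = noise_mean * expectation (\<lambda>\<omega>. vol 0 \<omega> * X (int k) \<omega>) + expectation (\<lambda>\<omega>. X (int k) \<omega> * nu 0 \<omega>)"
    using square_integrable_mult[OF vol_square_integrable X_square_integrable]
      square_integrable_mult[OF X_square_integrable nu_square_integrable] by simp
  also have "expectation (\<lambda>\<omega>. X (int k) \<omega> * nu 0 \<omega>) = nu_var * arch_z noise_mean b k"
    by (simp add: nu_X_cross)
  finally show ?thesis
    unfolding ser X_mean_equation[folded m_def, symmetric]
    by (simp add: autocovariance_eq m_def power2_eq_square)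
qed

text \<open>Both sides are bounded and satisfy the same forward recursion, so their difference is a bounded solution of
the homogeneous recursion and vanishes.\<close>
lemma autocovariance_formula:
  "autocovariance M X k =
     nu_var * (\<Sum>j. arch_z noise_mean b j * arch_z noise_mean b (j + nat \<bar>k\<bar>))"
proof -
  define z where "z = arch_z noise_mean b"
  define R where "R k = (\<Sum>j. z j * z (j + k))" for k
  have l: "noise_mean \<ge> 0" using noise_mean_pos by simp
  have z: "z n \<ge> 0" "summable z" for n
    unfolding z_def by (rule arch_z_nonneg[where b = b, OF l b_nonneg] arch_z_summable(1)[where b = b, OF l b_nonneg b_summable subcritical])+
  note R = autocorrelation_recursion[where b = b, OF l b_nonneg b_summable z_def z, folded R_def]
  define d where "d k = autocovariance M X (int k) - nu_var * R k" for k
  define c where "c j = noise_mean * b (Suc j)" for j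
  have c: "c j \<ge> 0" "summable c" "suminf c < 1" for j
    using l b_nonneg b_summable subcritical
    by (auto simp: c_def[abs_def] arch_coeff_sum_def suminf_mult)
  let ?K = "(L2norm M (X 0))\<^sup>2 + (expectation (X 0))\<^sup>2 + nu_var * (suminf z)\<^sup>2"
  have d_le: "\<bar>d k\<bar> \<le> ?K" for k
  proof -
    have "\<bar>nu_var * R k\<bar> \<le> nu_var * (suminf z)\<^sup>2"
      using R(2,3)[of k] nu_var_pos by (simp add: abs_mult)
    then show ?thesis using autocovariance_bounded[of "int k"] unfolding d_def by linarith
  qed
  have d_rec: "d k = (\<Sum>j. c j * d (k + Suc j))" for k
  proof -
    have s1: "summable (\<lambda>j. c j * autocovariance M X (int (k + Suc j)))"
    proof (rule summable_comparison_test)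
      show "summable (\<lambda>j. c j * ((L2norm M (X 0))\<^sup>2 + (expectation (X 0))\<^sup>2))"
        by (intro summable_mult2 c)
      show "\<exists>N. \<forall>n\<ge>N. norm (c n * autocovariance M X (int (k + Suc n))) \<le>
          c n * ((L2norm M (X 0))\<^sup>2 + (expectation (X 0))\<^sup>2)"
        using c(1) autocovariance_bounded by (auto simp: abs_mult intro!: mult_left_mono exI[of _ 0])
    qed
    have s2: "summable (\<lambda>j. c j * R (k + Suc j))"
    proof (rule summable_comparison_test)
      show "summable (\<lambda>j. c j * (suminf z)\<^sup>2)" by (intro summable_mult2 c)
      show "\<exists>N. \<forall>n\<ge>N. norm (c n * R (k + Suc n)) \<le> c n * (suminf z)\<^sup>2"
        using c(1) R(2,3) by (auto simp: abs_mult intro!: mult_left_mono exI[of _ 0])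
    qed
    have "(\<Sum>j. c j * d (k + Suc j)) =
        (\<Sum>j. c j * autocovariance M X (int (k + Suc j)) - nu_var * (c j * R (k + Suc j)))"
      by (simp only: d_def right_diff_distrib mult.left_commute)
    also have "\<dots> = (\<Sum>j. c j * autocovariance M X (int (k + Suc j))) - nu_var * (\<Sum>j. c j * R (k + Suc j))"
      using suminf_diff[OF s1 summable_mult[OF s2, of nu_var]] suminf_mult[OF s2, of nu_var] by (simp only:)
    also have "\<dots> = (autocovariance M X (int k) - nu_var * z k) - nu_var * (R k - z k)"
      unfolding autocovariance_recursion[of k] R(1)[of k] by (simp only: c_def z_def) simp
    finally show ?thesis by (simp add: d_def algebra_simps)
  qed
  have "d (nat \<bar>k\<bar>) = 0"
    by (rule bounded_forward_recursion_zero[OF c d_le d_rec])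
  moreover have "autocovariance M X (int (nat \<bar>k\<bar>)) = autocovariance M X k"
    using autocovariance_even[of k] by (cases "k \<ge> 0") auto
  ultimately show ?thesis by (simp add: d_def R_def z_def)
qed

end

section \<open>Asymptotics of the autocovariance\<close>

theorem theorem4:
  fixes M :: "'a measure"
    and \<xi> X :: "int \<Rightarrow> 'a \<Rightarrow> real"
    and b :: "nat \<Rightarrow> real"
    and a lam1 \<sigma> B :: real
    and \<rho> :: "int \<Rightarrow> real"
  assumes prob: "prob_space M"
    and indep: "prob_space.indep_vars M (\<lambda>_. borel) \<xi> UNIV"
    and ident: "\<And>k. distr M borel (\<xi> k) = distr M borel (\<xi> 0)"
    and xi_nonneg: "\<And>k. AE \<omega> in M. \<xi> k \<omega> \<ge> 0"
    and xi_int: "integrable M (\<xi> 0)"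
    and xi_sq_int: "integrable M (\<lambda>\<omega>. (\<xi> 0 \<omega>)\<^sup>2)"
    and lambda1: "lam1 = (\<integral>\<omega>. \<xi> 0 \<omega> \<partial>M)" "lam1 > 0"
    and sigma: "\<sigma> = sqrt ((\<integral>\<omega>. (\<xi> 0 \<omega>)\<^sup>2 \<partial>M) - lam1\<^sup>2)" "\<sigma> > 0"
    and a_pos: "a > 0"
    and b_nonneg: "\<And>j. j \<ge> 1 \<Longrightarrow> b j \<ge> 0"
    and b_nonzero: "\<exists>j\<ge>1. b j \<noteq> 0"
    and b_summable: "summable (\<lambda>j. b (Suc j))"
    and B: "B = arch_coeff_sum b"
    and mean_cond: "lam1 * B < 1"
    and Omega_cond: "arch_Omega lam1 \<sigma> b < 1"
    and solution: "arch_solution M a b \<xi> X"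
    and stationary: "weakly_stationary M X"
    and rho: "\<rho> = autocovariance M X"
    and b_class: "in_class_from1 b (weight_class_down 1)"
  shows "(\<lambda>n. \<rho> (int n)) \<in> weight_class_down 1 \<and>
    \<rho> summable_on UNIV \<and>
    (\<lambda>n. \<rho> (int n) / b n) \<longlonglongrightarrow> lam1 / (1 - lam1 * B) * (\<Sum>\<^sub>\<infinity>j\<in>UNIV. \<rho> j) \<and>
    lam1 / (1 - lam1 * B) * (\<Sum>\<^sub>\<infinity>j\<in>UNIV. \<rho> j) =
      lam1 * (\<integral>\<omega>. (arch_nu lam1 a b X 0 \<omega>)\<^sup>2 \<partial>M) / (1 - lam1 * B) ^ 3"
proof -
  interpret prob_space M by (rule prob)
  interpret iid_noise M \<xi>
    by unfold_locales (rule indep ident xi_sq_int)+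
  have mean: "noise_mean = lam1" using lambda1(1) by simp
  have var: "noise_var > 0" "noise_var = \<sigma>\<^sup>2"
    using sigma unfolding mean by (auto simp: real_sqrt_gt_0_iff)
  \<comment> \<open>The value at 0 is arbitrary; it makes the sequence positive from index 0 on.\<close>
  define \<beta> where "\<beta> = b(0 := 1)"
  have \<beta>: "\<beta> \<in> weight_class_down 1" "\<And>n. n > 0 \<Longrightarrow> \<beta> n = b n"
    using b_class by (auto simp: in_class_from1_def \<beta>_def)
  have \<beta>1: "\<beta> \<in> weight_class 1" using \<beta>(1) by (simp add: weight_class_down_def)
  define z where "z = arch_z lam1 b"
  have b0: "b (Suc j) \<ge> 0" for j by (rule b_nonneg) simp
  have l0: "lam1 \<ge> 0" using lambda1 by simp
  have z: "z n \<ge> 0" "summable z" "suminf z = 1 / (1 - lam1 * B)" for n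
    using arch_z_nonneg[of lam1 b, OF l0 b0] arch_z_summable[of lam1 b, OF l0 b0 b_summable] mean_cond
    by (auto simp: z_def B)
  have var_cond: "noise_var / noise_mean\<^sup>2 * (\<Sum>j. (arch_z noise_mean b (Suc j))\<^sup>2) < 1"
  proof -
    have "summable (\<lambda>j. (z j)\<^sup>2)"
      using autocorrelation_recursion(4)[where b = b, OF l0 b0 b_summable z_def z(1,2), of 0]
      by (simp add: power2_eq_square)
    then have "summable (\<lambda>j. (z (Suc j))\<^sup>2)" by (simp add: summable_Suc_iff[of "\<lambda>j. (z j)\<^sup>2"])
    then have z2: "0 \<le> (\<Sum>j. (z (Suc j))\<^sup>2)" by (rule suminf_nonneg) simp
    have "0 \<le> arch_Omega lam1 \<sigma> b"
      using sigma lambda1 z2 by (simp add: arch_Omega_def z_def)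
    then have "(arch_Omega lam1 \<sigma> b)\<^sup>2 < 1"
      using Omega_cond by (simp add: power_less_one_iff abs_square_less_1)
    then show ?thesis
      using z2 unfolding var(2) unfolding mean arch_Omega_def by (simp add: power_mult_distrib power_divide z_def)
  qed
  interpret arch_process M \<xi> a b X
  proof unfold_locales
    show "summable (\<lambda>n. L2norm M (noise_weight b k n))" for k
      by (rule noise_weight_L2norm_summable[OF \<beta>1 \<beta>(2)])
         (use lambda1 mean mean_cond B var var_cond in auto)
  qed (use xi_nonneg mean lambda1 var a_pos b0 b_summable mean_cond B solution stationary in auto)
  define v where "v = nu_var"
  define R where "R n = (\<Sum>j. z j * z (j + n))" for n
  have v: "v > 0" "v = (\<integral>\<omega>. (arch_nu lam1 a b X 0 \<omega>)\<^sup>2 \<partial>M)"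
    using nu_var_pos by (auto simp: v_def nu_var_def mean)
  have \<rho>: "\<rho> k = v * R (nat \<bar>k\<bar>)" for k
    unfolding rho autocovariance_formula v_def R_def z_def mean ..
  have S: "1 - lam1 * B > 0" using mean_cond by simp
  have total: "(\<rho> has_sum (v / (1 - lam1 * B)\<^sup>2)) UNIV"
    using has_sum_cmult_right[OF autocorrelation_has_sum[of z, OF z(1,2)], of v]
    by (simp add: \<rho>[abs_def] R_def z(3) power_divide)
  then have infsum: "(\<Sum>\<^sub>\<infinity>j\<in>UNIV. \<rho> j) = v / (1 - lam1 * B)\<^sup>2"
    by (rule infsumI)
  define L where "L = lam1 * v / (1 - lam1 * B) ^ 3"
  have "(\<lambda>n. z n / \<beta> n) \<longlonglongrightarrow> lam1 / (1 - lam1 * B)\<^sup>2"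
    unfolding z_def B by (rule arch_z_asymp[where b = b, OF \<beta>1 \<beta>(2) l0]) (use mean_cond B in auto)
  from tendsto_mult[OF tendsto_const[of v] autocorrelation_asymp[OF \<beta>(1) z(1,2) this]]
  have lim: "(\<lambda>n. \<rho> (int n) / \<beta> n) \<longlonglongrightarrow> L"
    by (simp add: \<rho> R_def z(3) L_def power3_eq_cube power2_eq_square mult_ac)
  have lim_b: "(\<lambda>n. \<rho> (int n) / b n) \<longlonglongrightarrow> L"
  proof (rule Lim_transform_eventually[OF lim])
    show "\<forall>\<^sub>F n in sequentially. \<rho> (int n) / \<beta> n = \<rho> (int n) / b n"
      using eventually_gt_at_top[of 0] by eventually_elim (simp add: \<beta>(2))
  qed
  have L: "L > 0" using v S lambda1 by (simp add: L_def)
  have \<rho>_pos: "\<rho> (int n) > 0" for n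
  proof -
    have "z n > 0"
    proof (cases n)
      case 0 then show ?thesis by (simp add: z_def)
    next
      case (Suc m)
      have "b (Suc m) > 0" using b_class by (simp add: in_class_from1_def)
      then have "0 < lam1 * b (Suc m)" using lambda1 by simp
      also have "\<dots> \<le> z n" unfolding z_def Suc by (rule arch_z_ge[where b = b, OF l0 b0])
      finally show ?thesis .
    qed
    then have "0 < z 0 * z (0 + n)" by (simp add: z_def)
    also have "\<dots> \<le> R n"
      unfolding R_def
      using sum_le_suminf[of "\<lambda>j. z j * z (j + n)" "{0}"] z(1)
        autocorrelation_recursion(4)[where b = b, OF l0 b0 b_summable z_def z(1,2), of n] by simp
    finally show ?thesis using v by (simp add: \<rho>)
  qed
  have "(\<lambda>n. \<rho> (int n)) \<in> weight_class_down 1"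
    by (rule weight_class_down_asymp[OF \<beta>(1) \<rho>_pos lim L])
  moreover have "\<rho> summable_on UNIV" using total by (rule has_sum_imp_summable)
  moreover have "lam1 / (1 - lam1 * B) * (\<Sum>\<^sub>\<infinity>j\<in>UNIV. \<rho> j) = L"
    by (simp add: infsum L_def power3_eq_cube power2_eq_square)
  ultimately show ?thesis
    using lim_b by (simp add: L_def v(2))
qed

end
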